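(* Let $\lambda,\mu,H>0$. If $\lambda\ne\mu$, the means of the renewal cycles starting from the origin are $$\mathbb E(C_{0,0})=\frac{2\lambda\left\{\lambda-\mu e^{2H(\mu-\lambda)}+(\mu-\lambda)e^{H(\mu-\lambda)}\left[1+H(\lambda+\mu)\right]\right\}}{(\lambda-\mu)\left(\lambda-\mu e^{H(\mu-\lambda)}\right)^2},$$ $$\mathbb E(C_{0,H})=\frac{e^{H(\mu-\lambda)}\left\{4\lambda\mu\left[-1+e^{H(\mu-\lambda)}\right]+H(\lambda^2-\mu^2)\left[\lambda+\mu e^{H(\mu-\lambda)}\right]\right\}}{(\lambda-\mu)\left(\lambda-\mu e^{(\mu-\lambda)H}\right)^2},$$ and the means of the renewal cycles starting from $H$ are $$\mathbb E(C_{H,0})=\frac{\mu e^{H(\lambda-\mu)}\left[\lambda(4+\lambda H)-\mu^2H\right]+\lambda e^{2H(\lambda-\mu)}\left[-4\mu+H(\lambda^2-\mu^2)\right]}{(\lambda-\mu)\left(\mu-\lambda e^{H(\lambda-\mu)}\right)^2},$$ $$\mathbb E(C_{H,H})=\frac{2\mu\left\{\lambda-\mu e^{2H(\mu-\lambda)}+(\mu-\lambda)e^{H(\mu-\lambda)}\left[1+H(\mu+\lambda)\right]\right\}}{(\lambda-\mu)\left(\lambda-\mu e^{(\mu-\lambda)H}\right)^2}.$$ If $\lambda=\mu$, then $$\mathbb E(C_{0,0})=\mathbb E(C_{H,H})=\frac{\mu H^2(3+2\mu H)}{3(1+\mu H)^2},\qquad \mathbb E(C_{0,H})=\mathbb E(C_{H,0})=\frac{H(3+3\mu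 H+\mu^2H^2)}{3(1+\mu H)^2}.$$
   Context: Setting. A particle moves on $[0,H]$ with unit speed, alternately upward for i.i.d. $\mathrm{Exp}(\lambda)$ times $U_1,U_2,\dots$ and downward for i.i.d. $\mathrm{Exp}(\mu)$ times $D_1,D_2,\dots$ (rates $\lambda,\mu>0$; all times independent). A particle starting at $0$ first moves up; a particle starting at $H$ first moves down, for an $\mathrm{Exp}(\mu)$ time $D$ independent of the other variables. Let $N(t)=\max\{n\ge 0:\sum_{i=1}^n U_i\le t\}$ (Poisson process of intensity $\lambda$) and $Y(t)=\sum_{n=1}^{N(t)}D_n$, $t\ge0$ (compound Poisson process, empty sum $=0$). With $\inf\emptyset=+\infty$, put $$T_{0,0}=\inf\{t>0:Y(t)\ge t\},\quad T_{0,H}=\inf\{t\ge H:Y(t)=t-H\},\quad T_0^*=\min\{T_{0,0},T_{0,H}\},$$ $$T_{H,H}(D)=\inf\{t\ge0:Y(t)=t-D\},\quad T_{H,0}(D)=\inf\{t\ge0:Y(t)\ge t-D+H\},\quad T_H^*(D)=\min\{T_{H,H}(D),T_{H,0}(D)\}.$$ The renewal cycles are $$C_{0,0}=\mathbf 1_{\{T_0^*=T_{0,0}\}}\,2T_{0,0},\qquad C_{0,H}=\mathbf 1_{\{T_0^*=T_{0,H}\}}(2T_{0,H}-H),$$ $$C_{H,H}=\mathbf 1_{\{T_H^*(D)=T_{H,H}(D)\}}\,2T_{H,H}(D),\qquad C_{H,0}=\mathbf 1_{\{T_H^*(D)=T_{H,0}(D)\}}(2T_{H,0}(D)+H),$$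 with $D\sim\mathrm{Exp}(\mu)$ independent of $Y$; each product is understood to be $0$ where the indicator vanishes. ($C_{u,v}$ is the time from leaving boundary $u$ to the next boundary hit, when that hit is at $v$, and $0$ otherwise.) *)

theory Defs
  imports "HOL-Probability.Probability"
begin

text \<open>
  The quantities below are functions of a sample path: \<open>u\<close> and \<open>d\<close> are the sequences of upward and
  downward times, with \<open>u i\<close> and \<open>d i\<close> standing for $U_{i+1}$ and $D_{i+1}$, and \<open>y\<close> is the duration
  of the initial downward move of a particle that starts at \<open>H\<close>.
\<close>

text \<open>
  Almost surely the set is finite, and for \<open>t \<ge> 0\<close> it contains \<open>0\<close>. On the null event where it is
  infinite, \<open>Max\<close> is an unspecified number.
\<close>
definition N :: "(nat \<Rightarrow> real) \<Rightarrow> real \<Rightarrow> nat" where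
  "N u t = Max {n. (\<Sum>i<n. u i) \<le> t}"

definition Y :: "(nat \<Rightarrow> real) \<Rightarrow> (nat \<Rightarrow> real) \<Rightarrow> real \<Rightarrow> real" where
  "Y u d t = (\<Sum>n<N u t. d n)"

text \<open>Infima are taken in \<^typ>\<open>ennreal\<close>, where the infimum of the empty set is \<open>\<infinity>\<close>.\<close>

definition T00 :: "(nat \<Rightarrow> real) \<Rightarrow> (nat \<Rightarrow> real) \<Rightarrow> ennreal" where
  "T00 u d = Inf (ennreal ` {t. 0 < t \<and> t \<le> Y u d t})"

definition T0H :: "real \<Rightarrow> (nat \<Rightarrow> real) \<Rightarrow> (nat \<Rightarrow> real) \<Rightarrow> ennreal" where
  "T0H H u d = Inf (ennreal ` {t. H \<le> t \<and> Y u d t = t - H})"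

definition T0_star :: "real \<Rightarrow> (nat \<Rightarrow> real) \<Rightarrow> (nat \<Rightarrow> real) \<Rightarrow> ennreal" where
  "T0_star H u d = min (T00 u d) (T0H H u d)"

definition THH :: "(nat \<Rightarrow> real) \<Rightarrow> (nat \<Rightarrow> real) \<Rightarrow> real \<Rightarrow> ennreal" where
  "THH u d y = Inf (ennreal ` {t. 0 \<le> t \<and> Y u d t = t - y})"

definition TH0 :: "real \<Rightarrow> (nat \<Rightarrow> real) \<Rightarrow> (nat \<Rightarrow> real) \<Rightarrow> real \<Rightarrow> ennreal" where
  "TH0 H u d y = Inf (ennreal ` {t. 0 \<le> t \<and> t - y + H \<le> Y u d t})"

definition TH_star :: "real \<Rightarrow> (nat \<Rightarrow> real) \<Rightarrow> (nat \<Rightarrow> real) \<Rightarrow> real \<Rightarrow> ennreal" where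
  "TH_star H u d y = min (THH u d y) (TH0 H u d y)"

definition C00 :: "real \<Rightarrow> (nat \<Rightarrow> real) \<Rightarrow> (nat \<Rightarrow> real) \<Rightarrow> ennreal" where
  "C00 H u d = (if T0_star H u d = T00 u d then 2 * T00 u d else 0)"

text \<open>The truncated subtraction of \<^typ>\<open>ennreal\<close> is harmless here, as \<open>T0H H u d \<ge> H\<close>.\<close>
definition C0H :: "real \<Rightarrow> (nat \<Rightarrow> real) \<Rightarrow> (nat \<Rightarrow> real) \<Rightarrow> ennreal" where
  "C0H H u d = (if T0_star H u d = T0H H u d then 2 * T0H H u d - ennreal H else 0)"

definition CHH :: "real \<Rightarrow> (nat \<Rightarrow> real) \<Rightarrow> (nat \<Rightarrow> real) \<Rightarrow> real \<Rightarrow> ennreal" where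
  "CHH H u d y = (if TH_star H u d y = THH u d y then 2 * THH u d y else 0)"

definition CH0 :: "real \<Rightarrow> (nat \<Rightarrow> real) \<Rightarrow> (nat \<Rightarrow> real) \<Rightarrow> real \<Rightarrow> ennreal" where
  "CH0 H u d y = (if TH_star H u d y = TH0 H u d y then 2 * TH0 H u d y + ennreal H else 0)"

text \<open>
  The extended nonnegative random variable \<open>X\<close> has the finite mean \<open>m\<close>. Random variables are only
  determined up to null events, so measurability refers to the completion; without it
  \<^const>\<open>nn_integral\<close> would only be a lower integral. The condition \<open>0 \<le> m\<close> is needed because
  \<^const>\<open>ennreal\<close> sends negative reals to \<open>0\<close>.
\<close>
definition has_mean :: "'a measure \<Rightarrow> ('a \<Rightarrow> ennreal) \<Rightarrow> real \<Rightarrow> bool" where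
  "has_mean M X m \<longleftrightarrow>
     X \<in> borel_measurable (completion M) \<and> 0 \<le> m \<and> (\<integral>\<^sup>+\<omega>. X \<omega> \<partial>completion M) = ennreal m"

end

theory Submission
  imports Defs
begin

text \<open>
  Follow the particle move by move. Let \<open>V\<close> be the mean total elapsed time, restricted to the event
  that the first boundary hit is the prescribed one, for a particle about to move in a given direction
  from position \<open>x\<close> with the clock showing \<open>s\<close>. It has the form \<open>m x + s * p x\<close>, where \<open>p\<close>
  is the probability of that event, and memorylessness turns the first-step equations into linear
  differential equations for \<open>m\<close> and \<open>p\<close> that have explicit solutions. Conversely, for any solution
  the process \<open>V\<close>(current state), stopped at the exit, is a martingale: one step is the integral of
  a derivative. The particle survives \<open>n\<close> moves with geometrically small probability and its clock is
  then at most \<open>n H\<close>, so the mean of the surviving part of \<open>V\<close> tends to \<open>0\<close> and \<open>V\<close> at the start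
  is the mean of the exit time. Reflecting \<open>[0, H]\<close> exchanges the two rates and the two boundaries,
  so only exits at \<open>0\<close> have to be solved.
\<close>

section \<open>Integration\<close>

text \<open>The equation for \<open>g\<close> makes \<open>- exp (- r * w) * g w\<close> an
  antiderivative of \<open>r * exp (- r * w) * h w\<close>. The boundary term left at
  \<open>a\<close> cancels against the tail mass \<open>exp (- r * a)\<close>, on which the constant
  \<open>g a\<close> is collected. The value of \<open>\<phi>\<close> at \<open>a\<close> itself is
  free, since a point is a null set.\<close>

lemma has_bochner_integral_exponential_stop:
  fixes g h \<phi> :: "real \<Rightarrow> real"
  assumes r: "0 < r" and a: "0 \<le> a"
    and g: "\<And>w. (g has_real_derivative r * (g w - h w)) (at w)"
    and h: "continuous_on UNIV h"
    and \<phi>[measurable]: "\<phi> \<in> borel_measurable borel"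
    and before: "\<And>w. 0 \<le> w \<Longrightarrow> w < a \<Longrightarrow> \<phi> w = h w"
    and after: "\<And>w. a < w \<Longrightarrow> \<phi> w = g a"
  shows "has_bochner_integral (density lborel (exponential_density r)) \<phi> (g 0)"
proof -
  have D: "((\<lambda>w. - exp (- r * w) * g w) has_real_derivative r * exp (- r * w) * h w) (at w)" for w
    by (auto intro!: derivative_eq_intros g simp: algebra_simps)
  have h': "continuous_on {0..a} (\<lambda>w. r * exp (- r * w) * h w)"
    by (intro continuous_intros continuous_on_subset[OF h]) auto
  have 1: "has_bochner_integral lborel (\<lambda>w. indicator {0..a} w *\<^sub>R (r * exp (- r * w) * h w))
      (- exp (- r * a) * g a - (- exp (- r * 0) * g 0))"
    using a h' D by (intro has_bochner_integral_FTC_Icc)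
      (auto simp: has_real_derivative_iff_has_vector_derivative intro: has_vector_derivative_at_within)
  have "(\<integral>\<^sup>+x. ennreal (r * exp (- r * x)) * indicator {a..} x \<partial>lborel) = 0 - (- exp (- r * a))"
  proof (rule nn_integral_FTC_atLeast)
    show "((\<lambda>x. - exp (- r * x)) has_real_derivative r * exp (- r * x)) (at x)" for x
      by (auto intro!: derivative_eq_intros)
    have "filterlim (\<lambda>x. - r * x) at_bot at_top"
      using filterlim_tendsto_pos_mult_at_top[OF tendsto_const r filterlim_ident]
      by (simp add: filterlim_uminus_at_bot)
    then have "((\<lambda>x. - exp (- r * x)) \<longlongrightarrow> - 0) at_top"
      by (intro tendsto_minus filterlim_compose[OF exp_at_bot])
    then show "((\<lambda>x. - exp (- r * x)) \<longlongrightarrow> 0) at_top" by simp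
  qed (use r in auto)
  then have "has_bochner_integral lborel (\<lambda>x. r * exp (- r * x) * indicator {a..} x) (exp (- r * a))"
    using r by (intro has_bochner_integral_nn_integral) (auto simp: ennreal_mult' ennreal_indicator)
  then have 2: "has_bochner_integral lborel (\<lambda>x. r * exp (- r * x) * indicator {a..} x * g a)
      (exp (- r * a) * g a)"
    by (rule has_bochner_integral_mult_left)
  have 3: "has_bochner_integral lborel (\<lambda>w. exponential_density r w *\<^sub>R \<phi> w) (g 0)"
  proof (rule has_bochner_integralI_AE)
    show "has_bochner_integral lborel (\<lambda>w. indicator {0..a} w *\<^sub>R (r * exp (- r * w) * h w)
        + r * exp (- r * w) * indicator {a..} w * g a) (g 0)"
      using has_bochner_integral_add[OF 1 2] by simp
    show "AE w in lborel. indicator {0..a} w *\<^sub>R (r * exp (- r * w) * h w)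
        + r * exp (- r * w) * indicator {a..} w * g a = exponential_density r w *\<^sub>R \<phi> w"
      using AE_lborel_singleton[of a]
    proof eventually_elim
      case (elim w)
      then consider "w < 0" | "0 \<le> w" "w < a" | "a < w" by linarith
      then show ?case
        using a by cases (auto simp: exponential_density_def before after indicator_def mult.commute)
    qed
  qed simp
  then show ?thesis
    using r by (intro has_bochner_integral_density) (auto simp: exponential_density_nonneg)
qed

text \<open>Injectivity makes the singleton blocks \<open>{f j}\<close> disjoint, so independence of
  blocks applies. This serves to flatten the family indexed by \<open>nat + nat + unit\<close> into
  one sequence of moves.\<close>

lemma (in prob_space) indep_vars_reindex:
  assumes "indep_vars M' X I" and f: "inj_on f J" "f ` J \<subseteq> I"
  shows "indep_vars (\<lambda>j. M' (f j)) (\<lambda>j. X (f j)) J"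
proof -
  have "indep_vars (\<lambda>j. PiM {f j} M') (\<lambda>j \<omega>. restrict (\<lambda>i. X i \<omega>) {f j}) J"
    using f by (intro indep_vars_restrict[OF assms(1)]) (auto simp: disjoint_family_on_def inj_on_def)
  then have "indep_vars (\<lambda>j. M' (f j)) (\<lambda>j \<omega>. (\<lambda>v. v (f j)) (restrict (\<lambda>i. X i \<omega>) {f j})) J"
    by (rule indep_vars_compose2) auto
  then show ?thesis by simp
qed

text \<open>Fubini for the product of the two laws: the first argument is frozen while the second is
  averaged. A bound along sample points suffices, because integrability is checked after pulling
  back to \<open>M\<close>.\<close>

lemma (in prob_space) expectation_indep_var:
  fixes f :: "'b \<Rightarrow> 'b \<Rightarrow> real"
  assumes ind: "indep_var S X T Z"
    and f: "(\<lambda>z. f (fst z) (snd z)) \<in> borel_measurable (S \<Otimes>\<^sub>M T)"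
    and bounded: "\<And>\<omega>. \<omega> \<in> space M \<Longrightarrow> \<bar>f (X \<omega>) (Z \<omega>)\<bar> \<le> C"
    and inner: "\<And>\<omega>. \<omega> \<in> space M \<Longrightarrow> expectation (\<lambda>\<omega>'. f (X \<omega>) (Z \<omega>')) = g \<omega>"
  shows "expectation (\<lambda>\<omega>. f (X \<omega>) (Z \<omega>)) = expectation g"
proof -
  have X[measurable]: "X \<in> measurable M S" and Z[measurable]: "Z \<in> measurable M T"
    and eq: "distr M S X \<Otimes>\<^sub>M distr M T Z = distr M (S \<Otimes>\<^sub>M T) (\<lambda>x. (X x, Z x))"
    using ind by (auto simp: indep_var_distribution_eq)
  interpret X: prob_space "distr M S X" by (rule prob_space_distr) fact
  interpret Z: prob_space "distr M T Z" by (rule prob_space_distr) fact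
  interpret XZ: pair_prob_space "distr M S X" "distr M T Z" ..
  let ?f = "\<lambda>z. f (fst z) (snd z)"
  have fXZ: "(\<lambda>\<omega>. f (X \<omega>) (Z \<omega>)) \<in> borel_measurable M"
    using measurable_compose[OF measurable_Pair[OF X Z] f] by simp
  have int: "integrable (distr M S X \<Otimes>\<^sub>M distr M T Z) ?f"
    unfolding eq using f fXZ bounded
    by (subst integrable_distr_eq) (auto intro!: integrable_const_bound[where B=C])
  have "expectation (\<lambda>\<omega>. f (X \<omega>) (Z \<omega>)) = integral\<^sup>L (distr M (S \<Otimes>\<^sub>M T) (\<lambda>x. (X x, Z x))) ?f"
    using f by (subst integral_distr) auto
  also have "\<dots> = (\<integral>x. (\<integral>y. ?f (x, y) \<partial>distr M T Z) \<partial>distr M S X)"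
    unfolding eq[symmetric] by (rule XZ.integral_fst'[OF int, symmetric])
  also have "\<dots> = expectation (\<lambda>\<omega>. \<integral>y. ?f (X \<omega>, y) \<partial>distr M T Z)"
    using borel_measurable_integrable[OF XZ.integrable_fst'[OF int]] by (subst integral_distr) auto
  also have "\<dots> = expectation g"
  proof (rule Bochner_Integration.integral_cong[OF refl])
    fix \<omega> assume \<omega>: "\<omega> \<in> space M"
    have "X \<omega> \<in> space S" using X \<omega> by (rule measurable_space)
    then have "(\<lambda>y. ?f (X \<omega>, y)) \<in> borel_measurable T"
      using f by (rule measurable_compose_Pair1)
    then show "(\<integral>y. ?f (X \<omega>, y) \<partial>distr M T Z) = g \<omega>"
      using inner[OF \<omega>] by (subst integral_distr) auto
  qed
  finally show ?thesis .
qed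

text \<open>\<open>X\<close> differs from a measurable series only on a null set, which the
  completion absorbs. Measurability thus never has to be traced through the infima that define the
  hitting times.\<close>

lemma has_mean_AE_suminf:
  assumes f: "\<And>n. f n \<in> borel_measurable M"
    and eq: "AE \<omega> in M. X \<omega> = (\<Sum>n. ennreal (f n \<omega>))"
    and int: "(\<integral>\<^sup>+\<omega>. (\<Sum>n. ennreal (f n \<omega>)) \<partial>M) = ennreal c" "0 \<le> c"
  shows "has_mean M X c"
proof -
  let ?G = "\<lambda>\<omega>. \<Sum>n. ennreal (f n \<omega>)"
  interpret completion: complete_measure "completion M" ..
  have G: "?G \<in> borel_measurable (completion M)"
    using f by (intro measurable_completion) measurable
  have ae: "AE \<omega> in completion M. X \<omega> = ?G \<omega>"
    using eq by (rule AE_completion)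
  have "X \<in> borel_measurable (completion M)"
  proof (rule measurableI)
    fix A :: "ennreal set" assume A: "A \<in> sets borel"
    show "X -` A \<inter> space (completion M) \<in> sets (completion M)"
    proof (rule completion.in_sets_AE)
      show "AE \<omega> in completion M. \<omega> \<in> ?G -` A \<inter> space (completion M) \<longleftrightarrow> \<omega> \<in> X -` A \<inter> space (completion M)"
        using ae by eventually_elim auto
      show "?G -` A \<inter> space (completion M) \<in> sets (completion M)"
        using G A by (rule measurable_sets)
    qed auto
  qed auto
  moreover have "(\<integral>\<^sup>+\<omega>. X \<omega> \<partial>completion M) = ennreal c"
    using int(1) nn_integral_cong_AE[OF ae] by (simp add: nn_integral_completion)
  ultimately show ?thesis using int(2) by (simp add: has_mean_def)
qed

section \<open>Alternating paths\<close>

text \<open>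
  Paths are sequences \<open>w\<close> of durations of alternating moves, \<open>b\<close> telling whether the first one is upward.
  An upward move exits only if it strictly overshoots \<open>H\<close>, a downward move already if it just reaches
  \<open>0\<close>: this is what \<^const>\<open>THH\<close> and \<^const>\<open>TH0\<close> see, since \<^const>\<open>Y\<close> is right-continuous, and it
  makes the comparison with them free of exceptional ties.
\<close>

definition up_move :: "bool \<Rightarrow> nat \<Rightarrow> bool" where
  "up_move b n \<longleftrightarrow> even n = b"

definition shift :: "bool \<Rightarrow> real \<Rightarrow> real \<Rightarrow> real" where
  "shift up x w = (if up then x + w else x - w)"

definition pos :: "bool \<Rightarrow> real \<Rightarrow> (nat \<Rightarrow> real) \<Rightarrow> nat \<Rightarrow> real" where
  "pos b x w n = x + (\<Sum>i<n. if up_move b i then w i else - w i)"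

definition elapsed :: "(nat \<Rightarrow> real) \<Rightarrow> nat \<Rightarrow> real" where
  "elapsed w n = (\<Sum>i<n. w i)"

definition stays :: "real \<Rightarrow> bool \<Rightarrow> real \<Rightarrow> bool" where
  "stays H up z \<longleftrightarrow> z \<le> H \<and> (if up then 0 \<le> z else 0 < z)"

definition leaves :: "real \<Rightarrow> bool \<Rightarrow> real \<Rightarrow> bool" where
  "leaves H up z \<longleftrightarrow> (if up then H < z else z \<le> 0)"

text \<open>Only the ends of moves are tested, since the position is monotone during a move.\<close>

definition inside :: "real \<Rightarrow> bool \<Rightarrow> real \<Rightarrow> (nat \<Rightarrow> real) \<Rightarrow> nat \<Rightarrow> bool" where
  "inside H b x w n \<longleftrightarrow> (\<forall>k<n. stays H (up_move b k) (pos b x w (Suc k)))"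

definition exits :: "real \<Rightarrow> bool \<Rightarrow> real \<Rightarrow> (nat \<Rightarrow> real) \<Rightarrow> nat \<Rightarrow> bool" where
  "exits H b x w n \<longleftrightarrow> inside H b x w n \<and> leaves H (up_move b n) (pos b x w (Suc n))"

definition reach :: "real \<Rightarrow> bool \<Rightarrow> real \<Rightarrow> real" where
  "reach H up x = (if up then H - x else x)"

text \<open>The exit move is cut off at the boundary, and at unit speed it lasts
  \<open>reach\<close> until then. At most one \<open>n\<close> satisfies \<open>exits\<close>, so
  the sum over \<open>n\<close> is the exit time restricted to exits at the chosen boundary.\<close>

definition payoff :: "real \<Rightarrow> bool \<Rightarrow> bool \<Rightarrow> real \<Rightarrow> (nat \<Rightarrow> real) \<Rightarrow> nat \<Rightarrow> real" where
  "payoff H atH b x w n =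
    (if exits H b x w n \<and> up_move b n = atH
     then elapsed w n + reach H atH (pos b x w n) else 0)"

lemma pos_Suc: "pos b x w (Suc n) = shift (up_move b n) (pos b x w n) (w n)"
  by (simp add: pos_def shift_def)

lemma up_move_Suc: "up_move b (Suc n) \<longleftrightarrow> \<not> up_move b n"
  by (auto simp: up_move_def)

lemma elapsed_Suc: "elapsed w (Suc n) = elapsed w n + w n"
  by (simp add: elapsed_def)

lemma inside_Suc:
  "inside H b x w (Suc n) \<longleftrightarrow> inside H b x w n \<and> stays H (up_move b n) (pos b x w (Suc n))"
  by (auto simp: inside_def less_Suc_eq)

lemma inside_pos:
  assumes "0 \<le> x" "x \<le> H" "inside H b x w n"
  shows "0 \<le> pos b x w n" "pos b x w n \<le> H"
proof -
  have "0 \<le> pos b x w n \<and> pos b x w n \<le> H"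
    using assms by (cases n) (auto simp: inside_Suc stays_def pos_def[of b x w 0] split: if_splits)
  then show "0 \<le> pos b x w n" "pos b x w n \<le> H" by auto
qed

lemma inside_move:
  assumes "0 \<le> x" "x \<le> H" "inside H b x w (Suc n)"
  shows "\<bar>w n\<bar> \<le> H"
  using inside_pos[OF assms] inside_pos[OF assms(1,2), of b w n] assms(3)
  by (auto simp: inside_Suc pos_Suc shift_def split: if_splits)

text \<open>A move between two points of \<open>[0, H]\<close> has length at most \<open>H\<close>.
  The absolute values keep the bound valid at every sample point, even where durations are
  negative.\<close>

lemma inside_elapsed:
  assumes "0 \<le> x" "x \<le> H" "inside H b x w n"
  shows "\<bar>elapsed w n\<bar> \<le> real n * H"
  using assms(3)
proof (induction n)
  case (Suc n)
  then have "\<bar>elapsed w n\<bar> \<le> real n * H" by (simp add: inside_Suc)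
  with inside_move[OF assms(1,2) Suc.prems] show ?case
    by (simp add: elapsed_Suc algebra_simps)
qed (simp add: elapsed_def)

lemma inside_le: "inside H b x w n \<Longrightarrow> k \<le> n \<Longrightarrow> inside H b x w k"
  by (auto simp: inside_def)

lemma exits_unique: "exits H b x w m \<Longrightarrow> exits H b x w n \<Longrightarrow> m = n"
proof (induction m n rule: linorder_wlog)
  case (le m n)
  show ?case
  proof (rule ccontr)
    assume "m \<noteq> n"
    with le have "inside H b x w (Suc m)" by (auto simp: exits_def intro: inside_le)
    with le show False by (auto simp: exits_def inside_Suc stays_def leaves_def split: if_splits)
  qed
qed simp

text \<open>Positive durations force the first move that violates \<open>stays\<close> to violate it
  on the side it is heading for, which is what \<open>leaves\<close> demands.\<close>

lemma exits_exists:
  assumes x: "0 \<le> x" "x \<le> H" and w: "\<And>n. 0 < w n" and ex: "\<not> inside H b x w n"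
  obtains k where "exits H b x w k"
proof -
  define m where "m = (LEAST n. \<not> inside H b x w n)"
  have m: "\<not> inside H b x w m" unfolding m_def by (rule LeastI[of "\<lambda>n. \<not> inside H b x w n", OF ex])
  then obtain k where k: "m = Suc k" by (cases m) (auto simp: inside_def)
  have i: "inside H b x w k" using not_less_Least[of k "\<lambda>n. \<not> inside H b x w n"] unfolding m_def[symmetric] k by blast
  have "\<not> stays H (up_move b k) (pos b x w (Suc k))"
    using m i by (simp add: k inside_Suc)
  with inside_pos[OF x i] w[of k] have "leaves H (up_move b k) (pos b x w (Suc k))"
    by (auto simp: stays_def leaves_def pos_Suc shift_def split: if_splits)
  with i show ?thesis by (intro that[of k]) (simp add: exits_def)
qed

lemma payoff_nonneg:
  assumes x: "0 \<le> x" "x \<le> H" and w: "\<And>n. 0 < w n"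
  shows "0 \<le> payoff H atH b x w n"
proof -
  have "0 \<le> elapsed w n" unfolding elapsed_def by (intro sum_nonneg less_imp_le[OF w])
  then show ?thesis using inside_pos[OF x, of b w n] by (auto simp: payoff_def exits_def reach_def)
qed

lemma payoff_suminf:
  assumes "exits H b x w n"
  shows "(\<Sum>k. ennreal (payoff H atH b x w k)) = ennreal (payoff H atH b x w n)"
proof -
  have "payoff H atH b x w k = 0" if "k \<noteq> n" for k
    using exits_unique[OF assms] that by (auto simp: payoff_def)
  then have "(\<Sum>k. ennreal (payoff H atH b x w k)) = (\<Sum>k\<in>{n}. ennreal (payoff H atH b x w k))"
    by (intro suminf_finite) auto
  then show ?thesis by simp
qed

lemma DERIV_x_plus: "((\<lambda>w. x + w) has_real_derivative 1) (at w)" for x :: real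
  by (auto intro!: derivative_eq_intros)

lemma DERIV_x_minus: "((\<lambda>w. x - w) has_real_derivative - 1) (at w)" for x :: real
  by (auto intro!: derivative_eq_intros)

section \<open>Value functions\<close>

text \<open>
  The equations say that \<open>m up x + s * p up x\<close> solves the backward equation of the process with clock,
  for exits at \<open>H\<close> or at \<open>0\<close> according to \<open>atH\<close>.
\<close>

locale exit_values =
  fixes lam mu H :: real and atH :: bool and p m :: "bool \<Rightarrow> real \<Rightarrow> real"
  assumes H: "0 < H"
    and p_up: "\<And>x. (p True has_real_derivative lam * (p True x - p False x)) (at x)"
    and p_down: "\<And>x. (p False has_real_derivative mu * (p True x - p False x)) (at x)"
    and m_up: "\<And>x. (m True has_real_derivative lam * (m True x - m False x) - p True x) (at x)"
    and m_down: "\<And>x. (m False has_real_derivative mu * (m True x - m False x) + p False x) (at x)"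
    and boundary: "p True H = (if atH then 1 else 0)" "p False 0 = (if atH then 0 else 1)"
      "m True H = 0" "m False 0 = 0"
begin

definition V :: "bool \<Rightarrow> real \<Rightarrow> real \<Rightarrow> real" where
  "V up x s = m up x + s * p up x"

text \<open>The yield of one move of length \<open>w\<close>: the value of the next state at the
  advanced clock if the particle survives, or the hitting time itself on an exit at the prescribed
  boundary.\<close>

definition step :: "bool \<Rightarrow> real \<Rightarrow> real \<Rightarrow> real \<Rightarrow> real" where
  "step up x s w =
    (if stays H up (shift up x w) then V (\<not> up) (shift up x w) (s + w) else 0) +
    (if leaves H up (shift up x w) \<and> up = atH then s + reach H atH x else 0)"

lemma continuous_p: "continuous_on A (p up)"
  using DERIV_continuous[OF p_up] DERIV_continuous[OF p_down]
  by (cases up) (auto intro!: continuous_at_imp_continuous_on)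

lemma continuous_m: "continuous_on A (m up)"
  using DERIV_continuous[OF m_up] DERIV_continuous[OF m_down]
  by (cases up) (auto intro!: continuous_at_imp_continuous_on)

lemmas continuous_comp_p[continuous_intros] = continuous_on_compose2[OF continuous_p, OF _ subset_UNIV]
lemmas continuous_comp_m[continuous_intros] = continuous_on_compose2[OF continuous_m, OF _ subset_UNIV]

lemma measurable_p[measurable]: "p up \<in> borel_measurable borel"
  by (intro borel_measurable_continuous_onI continuous_p)

lemma measurable_m[measurable]: "m up \<in> borel_measurable borel"
  by (intro borel_measurable_continuous_onI continuous_m)

lemma V_bounded:
  obtains C where "0 \<le> C" "\<And>up x s. 0 \<le> x \<Longrightarrow> x \<le> H \<Longrightarrow> \<bar>V up x s\<bar> \<le> C * (1 + \<bar>s\<bar>)"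
proof -
  have bd: "\<exists>C\<ge>0. \<forall>x\<in>{0..H}. \<bar>f x\<bar> \<le> C" if "continuous_on {0..H} f" for f :: "real \<Rightarrow> real"
  proof -
    have "bounded (f ` {0..H})"
      by (intro compact_imp_bounded compact_continuous_image that compact_Icc)
    then obtain C where "C > 0" "\<forall>x\<in>f ` {0..H}. norm x \<le> C" using bounded_pos by metis
    then show ?thesis by (intro exI[of _ C]) auto
  qed
  have "\<forall>up. \<exists>C\<ge>0. \<forall>x\<in>{0..H}. \<bar>p up x\<bar> \<le> C" "\<forall>up. \<exists>C\<ge>0. \<forall>x\<in>{0..H}. \<bar>m up x\<bar> \<le> C"
    using bd continuous_p continuous_m by auto
  then obtain P Q where P: "\<And>up. P up \<ge> 0" "\<And>up x. x \<in> {0..H} \<Longrightarrow> \<bar>p up x\<bar> \<le> P up"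
    and Q: "\<And>up. Q up \<ge> 0" "\<And>up x. x \<in> {0..H} \<Longrightarrow> \<bar>m up x\<bar> \<le> Q up"
    by metis
  define C where "C = P True + P False + Q True + Q False"
  show ?thesis
  proof (rule that)
    show "0 \<le> C" using P(1) Q(1) by (simp add: C_def)
    fix up x s assume x: "0 \<le> x" "x \<le> H"
    have "\<bar>m up x\<bar> \<le> C" "\<bar>p up x\<bar> \<le> C"
      using P(1)[of True] P(1)[of False] Q(1)[of True] Q(1)[of False] P(2)[of x up] Q(2)[of x up] x
      by (cases up; simp add: C_def)+
    then have "\<bar>m up x\<bar> + \<bar>s\<bar> * \<bar>p up x\<bar> \<le> C + \<bar>s\<bar> * C"
      by (intro add_mono mult_left_mono) auto
    then show "\<bar>V up x s\<bar> \<le> C * (1 + \<bar>s\<bar>)"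
      using abs_triangle_ineq[of "m up x" "s * p up x"] by (simp add: V_def abs_mult algebra_simps)
  qed
qed

lemma measurable_V[measurable (raw)]:
  assumes [measurable]: "f \<in> borel_measurable S" "g \<in> borel_measurable S"
  shows "(\<lambda>z. V up (f z) (g z)) \<in> borel_measurable S"
  unfolding V_def by measurable

lemma measurable_step[measurable (raw)]:
  assumes [measurable]: "f \<in> borel_measurable S" "g \<in> borel_measurable S" "h \<in> borel_measurable S"
  shows "(\<lambda>z. step up (f z) (g z) (h z)) \<in> borel_measurable S"
proof (cases up)
  case True
  have "(\<lambda>z. (if f z + h z \<le> H \<and> 0 \<le> f z + h z then V False (f z + h z) (g z + h z) else 0) +
      (if H < f z + h z \<and> atH then g z + (H - f z) else 0)) \<in> borel_measurable S"
    by measurable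
  then show ?thesis
    using True by (simp add: step_def stays_def leaves_def shift_def reach_def cong: if_cong)
next
  case False
  have "(\<lambda>z. (if f z - h z \<le> H \<and> 0 < f z - h z then V True (f z - h z) (g z + h z) else 0) +
      (if f z - h z \<le> 0 \<and> \<not> atH then g z + f z else 0)) \<in> borel_measurable S"
    by measurable
  then show ?thesis
    using False by (simp add: step_def stays_def leaves_def shift_def reach_def cong: if_cong)
qed

lemma p_right: "((\<lambda>w. p True (x + w)) has_real_derivative lam * (p True (x + w) - p False (x + w))) (at w)"
  using DERIV_chain2[OF p_up DERIV_x_plus] by simp

lemma m_right: "((\<lambda>w. m True (x + w)) has_real_derivative
    lam * (m True (x + w) - m False (x + w)) - p True (x + w)) (at w)"
  using DERIV_chain2[OF m_up DERIV_x_plus] by simp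

lemma p_left: "((\<lambda>w. p False (x - w)) has_real_derivative - (mu * (p True (x - w) - p False (x - w)))) (at w)"
  using DERIV_chain2[OF p_down DERIV_x_minus] by simp

lemma m_left: "((\<lambda>w. m False (x - w)) has_real_derivative
    - (mu * (m True (x - w) - m False (x - w)) + p False (x - w))) (at w)"
  using DERIV_chain2[OF m_down DERIV_x_minus] by simp

text \<open>The martingale property for one move. Along the move \<open>V\<close> satisfies the
  equation required of \<open>g\<close> in \<open>has_bochner_integral_exponential_stop\<close>,
  with \<open>h\<close> the value after turning and \<open>a\<close> the distance to the boundary
  ahead.\<close>

lemma step_mean:
  assumes rates: "0 < lam" "0 < mu" and x: "0 \<le> x" "x \<le> H"
  shows "has_bochner_integral (density lborel (exponential_density (if up then lam else mu)))
    (step up x s) (V up x s)"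
proof (cases up)
  case True
  have "has_bochner_integral (density lborel (exponential_density lam)) (step up x s)
      (V True (x + 0) (s + 0))"
  proof (rule has_bochner_integral_exponential_stop[where a="H - x" and h="\<lambda>w. V False (x + w) (s + w)"])
    fix w
    show "((\<lambda>w. V True (x + w) (s + w)) has_real_derivative
        lam * (V True (x + w) (s + w) - V False (x + w) (s + w))) (at w)"
      \<comment> \<open>The running clock adds \<open>p True (x + w)\<close> to the derivative,
        which cancels the inhomogeneous term of \<open>m_up\<close>.\<close>
      unfolding V_def
      by (rule DERIV_cong, rule DERIV_add[OF m_right DERIV_mult[OF _ p_right]])
        (auto intro!: derivative_eq_intros simp: algebra_simps)
    \<comment> \<open>Since \<open>m True H = 0\<close> and \<open>p True H\<close> is
      \<open>1\<close> or \<open>0\<close>, the value at the boundary is the hitting time or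
      \<open>0\<close>, according to \<open>atH\<close>.\<close>
    show "step up x s w = V True (x + (H - x)) (s + (H - x))" if "H - x < w"
      using that True by (auto simp: step_def stays_def leaves_def shift_def V_def boundary reach_def)
    show "step up x s w = V False (x + w) (s + w)" if "0 \<le> w" "w < H - x"
      using that True x by (auto simp: step_def stays_def leaves_def shift_def)
  next
    show "continuous_on UNIV (\<lambda>w. V False (x + w) (s + w))"
      unfolding V_def by (intro continuous_intros)
    show "step up x s \<in> borel_measurable borel"
      by (rule measurable_step) auto
  qed (use x rates in auto)
  then show ?thesis using True by simp
next
  case False
  have "has_bochner_integral (density lborel (exponential_density mu)) (step up x s)
      (V False (x - 0) (s + 0))"
  proof (rule has_bochner_integral_exponential_stop[where a=x and h="\<lambda>w. V True (x - w) (s + w)"])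
    fix w
    show "((\<lambda>w. V False (x - w) (s + w)) has_real_derivative
        mu * (V False (x - w) (s + w) - V True (x - w) (s + w))) (at w)"
      unfolding V_def
      by (rule DERIV_cong, rule DERIV_add[OF m_left DERIV_mult[OF _ p_left]])
        (auto intro!: derivative_eq_intros simp: algebra_simps)
    show "step up x s w = V False (x - x) (s + x)" if "x < w"
      using that False by (auto simp: step_def stays_def leaves_def shift_def V_def boundary reach_def)
    show "step up x s w = V True (x - w) (s + w)" if "0 \<le> w" "w < x"
      using that False x by (auto simp: step_def stays_def leaves_def shift_def)
  next
    show "continuous_on UNIV (\<lambda>w. V True (x - w) (s + w))"
      unfolding V_def by (intro continuous_intros)
    show "step up x s \<in> borel_measurable borel"
      by (rule measurable_step) auto
  qed (use x rates in auto)
  then show ?thesis using False by simp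
qed

end

section \<open>Optional stopping\<close>

locale alternating_moves = prob_space M for M :: "'a measure" +
  fixes W :: "nat \<Rightarrow> 'a \<Rightarrow> real" and b :: bool and lam mu :: real
  assumes rates: "0 < lam" "0 < mu"
    and indep: "indep_vars (\<lambda>_. borel) W UNIV"
    and law: "\<And>n. distributed M lborel (W n) (exponential_density (if up_move b n then lam else mu))"
begin

lemma measurable_W[measurable]: "W n \<in> borel_measurable M"
  using distributed_measurable[OF law[of n]] by simp

lemma measurable_pos[measurable]: "(\<lambda>\<omega>. pos b x (\<lambda>i. W i \<omega>) n) \<in> borel_measurable M"
  unfolding pos_def by measurable

lemma measurable_elapsed[measurable]: "(\<lambda>\<omega>. elapsed (\<lambda>i. W i \<omega>) n) \<in> borel_measurable M"
  unfolding elapsed_def by measurable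

lemma measurable_stays[measurable]: "Measurable.pred borel (stays H up)"
  unfolding stays_def by measurable

lemma measurable_inside[measurable]: "Measurable.pred M (\<lambda>\<omega>. inside H b x (\<lambda>i. W i \<omega>) n)"
  unfolding inside_def by measurable

lemma measurable_payoff[measurable]:
  "(\<lambda>\<omega>. payoff H atH b x (\<lambda>i. W i \<omega>) n) \<in> borel_measurable M"
  unfolding payoff_def exits_def leaves_def reach_def by (cases "up_move b n"; cases atH; simp)

lemma AE_W_pos: "AE \<omega> in M. \<forall>n. 0 < W n \<omega>"
proof (subst AE_all_countable, rule allI)
  fix n
  have "prob {\<omega>\<in>space M. 0 < W n \<omega>} = 1"
    using exponential_distributedD_gt[OF law, of 0 n] rates by auto
  then show "AE \<omega> in M. 0 < W n \<omega>"
    by (simp add: prob_Collect_eq_1)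
qed

text \<open>Survival of \<open>n\<close> moves forces all \<open>n\<close> independent durations to
  be at most \<open>H\<close>; the larger rate gives the common bound. The product formula for
  independent events is used for a nonempty index set, hence the separate case
  \<open>n = 0\<close>.\<close>

lemma prob_inside_le:
  assumes H: "0 < H" and x: "0 \<le> x" "x \<le> H"
  shows "prob {\<omega>\<in>space M. inside H b x (\<lambda>i. W i \<omega>) n} \<le> (1 - exp (- H * max lam mu)) ^ n"
proof (cases "n = 0")
  case False
  have "prob {\<omega>\<in>space M. inside H b x (\<lambda>i. W i \<omega>) n} \<le> prob (\<Inter>i\<in>{..<n}. W i -` {..H} \<inter> space M)"
  proof (rule finite_measure_mono)
    have "W i \<omega> \<le> H" if "inside H b x (\<lambda>i. W i \<omega>) n" "i < n" for i \<omega>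
      using inside_move[OF x inside_le[OF that(1), of "Suc i"]] that(2) by auto
    with False show "{\<omega>\<in>space M. inside H b x (\<lambda>i. W i \<omega>) n} \<subseteq> (\<Inter>i\<in>{..<n}. W i -` {..H} \<inter> space M)"
      by auto
    show "(\<Inter>i\<in>{..<n}. W i -` {..H} \<inter> space M) \<in> events"
      using False by (intro sets.finite_INT) auto
  qed
  also have "\<dots> = (\<Prod>i<n. prob (W i -` {..H} \<inter> space M))"
    using False by (intro indep_varsD[OF indep]) auto
  also have "\<dots> \<le> (\<Prod>i<n. 1 - exp (- H * max lam mu))"
  proof (intro prod_mono conjI)
    fix i
    have "W i -` {..H} \<inter> space M = {\<omega>\<in>space M. W i \<omega> \<le> H}" by auto
    then have "prob (W i -` {..H} \<inter> space M) = 1 - exp (- H * (if up_move b i then lam else mu))"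
      using exponential_distributedD_le[OF law[of i], of H] H rates by auto
    then show "prob (W i -` {..H} \<inter> space M) \<le> 1 - exp (- H * max lam mu)"
      using H by auto
  qed simp
  finally show ?thesis by simp
qed simp

lemma AE_exits:
  assumes H: "0 < H" and x: "0 \<le> x" "x \<le> H"
  shows "AE \<omega> in M. \<exists>n. exits H b x (\<lambda>i. W i \<omega>) n"
proof -
  let ?q = "1 - exp (- H * max lam mu)"
  have q: "0 \<le> ?q" "?q < 1" using H rates by auto
  have "prob {\<omega>\<in>space M. \<forall>n. inside H b x (\<lambda>i. W i \<omega>) n} \<le> ?q ^ n" for n
    by (rule order_trans[OF _ prob_inside_le[OF assms, of n]]) (auto intro!: finite_measure_mono)
  then have "prob {\<omega>\<in>space M. \<forall>n. inside H b x (\<lambda>i. W i \<omega>) n} \<le> 0"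
    by (intro LIMSEQ_le_const[OF LIMSEQ_realpow_zero[OF q]]) auto
  then have "prob {\<omega>\<in>space M. \<not> (\<exists>n. \<not> inside H b x (\<lambda>i. W i \<omega>) n)} = 0"
    by (simp add: measure_le_0_iff)
  then have "AE \<omega> in M. \<exists>n. \<not> inside H b x (\<lambda>i. W i \<omega>) n"
    by (subst (asm) prob_Collect_eq_0) auto
  with AE_W_pos show ?thesis
    by eventually_elim (metis exits_exists[OF x])
qed

section \<open>Finite histories and their independence of the next move\<close>

abbreviation past :: "nat \<Rightarrow> (nat \<Rightarrow> real) measure" where
  "past n \<equiv> PiM {..<n} (\<lambda>_. borel)"

lemma measurable_pos_past[measurable]: "k \<le> n \<Longrightarrow> (\<lambda>w. pos b x w k) \<in> borel_measurable (past n)"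
  unfolding pos_def by measurable

lemma measurable_elapsed_past[measurable]: "(\<lambda>w. elapsed w n) \<in> borel_measurable (past n)"
  unfolding elapsed_def by measurable

lemma measurable_inside_past[measurable]: "Measurable.pred (past n) (\<lambda>w. inside H b x w n)"
proof -
  have "Measurable.pred (past n) (\<lambda>w. \<forall>k\<in>{..<n}. stays H (up_move b k) (pos b x w (Suc k)))"
    by (intro pred_intros_finite) (auto intro!: measurable_compose[OF _ measurable_stays])
  then show ?thesis by (simp add: inside_def Ball_def)
qed

lemma indep_past:
  "indep_var (past n) (\<lambda>\<omega>. restrict (\<lambda>i. W i \<omega>) {..<n})
     (PiM {n} (\<lambda>_. borel)) (\<lambda>\<omega>. restrict (\<lambda>i. W i \<omega>) {n})"
  by (rule indep_var_restrict[OF indep]) auto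

text \<open>Restriction makes the later coordinates \<open>undefined\<close>, but the first
  \<open>k \<le> n\<close> moves do not read them.\<close>

lemma pos_restrict[simp]: "k \<le> n \<Longrightarrow> pos b x (restrict w {..<n}) k = pos b x w k"
  unfolding pos_def by (intro arg_cong2[where f="(+)"] sum.cong) auto

lemma elapsed_restrict[simp]: "elapsed (restrict w {..<n}) n = elapsed w n"
  by (simp add: elapsed_def)

lemma inside_restrict[simp]: "inside H b x (restrict w {..<n}) n = inside H b x w n"
  by (simp add: inside_def)

end

locale exit_problem = alternating_moves M W b lam mu + exit_values lam mu H atH p m
  for M :: "'a measure" and W :: "nat \<Rightarrow> 'a \<Rightarrow> real" and b :: bool and lam mu H :: real
    and atH :: bool and p m :: "bool \<Rightarrow> real \<Rightarrow> real" +
  fixes x :: real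
  assumes start: "0 \<le> x" "x \<le> H"
begin

text \<open>The value of the current state, set to \<open>0\<close> after the exit, when the exit
  time has already been collected in \<open>pay\<close>.\<close>

definition val :: "nat \<Rightarrow> 'a \<Rightarrow> real" where
  "val n \<omega> = (if inside H b x (\<lambda>i. W i \<omega>) n
     then V (up_move b n) (pos b x (\<lambda>i. W i \<omega>) n) (elapsed (\<lambda>i. W i \<omega>) n) else 0)"

definition pay :: "nat \<Rightarrow> 'a \<Rightarrow> real" where
  "pay n \<omega> = payoff H atH b x (\<lambda>i. W i \<omega>) n"

lemma measurable_val[measurable]: "val n \<in> borel_measurable M"
  unfolding val_def by measurable

lemma measurable_pay[measurable]: "pay n \<in> borel_measurable M"
  unfolding pay_def by measurable

text \<open>The indicator is kept so that the geometric survival probability can later beat the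
  linear growth of the clock.\<close>

lemma val_bounded:
  obtains C where "0 \<le> C"
    "\<And>n \<omega>. \<bar>val n \<omega>\<bar> \<le> C * (1 + real n * H) * indicator {\<omega>. inside H b x (\<lambda>i. W i \<omega>) n} \<omega>"
proof -
  obtain C where C: "0 \<le> C" "\<And>up x s. 0 \<le> x \<Longrightarrow> x \<le> H \<Longrightarrow> \<bar>V up x s\<bar> \<le> C * (1 + \<bar>s\<bar>)"
    using V_bounded by blast
  show ?thesis
  proof (rule that[OF C(1)])
    fix n \<omega>
    show "\<bar>val n \<omega>\<bar> \<le> C * (1 + real n * H) * indicator {\<omega>. inside H b x (\<lambda>i. W i \<omega>) n} \<omega>"
    proof (cases "inside H b x (\<lambda>i. W i \<omega>) n")
      case True
      note i = inside_pos[OF start True] inside_elapsed[OF start True]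
      have "C * (1 + \<bar>elapsed (\<lambda>i. W i \<omega>) n\<bar>) \<le> C * (1 + real n * H)"
        using i C(1) by (intro mult_left_mono) auto
      then show ?thesis using C(2)[OF i(1,2)] True by (auto simp: val_def intro: order_trans)
    qed (simp add: val_def)
  qed
qed

lemma pay_bounded: "\<bar>pay n \<omega>\<bar> \<le> real n * H + H"
proof (cases "inside H b x (\<lambda>i. W i \<omega>) n")
  case True
  show ?thesis
    using inside_pos[OF start True] inside_elapsed[OF start True] H
    by (auto simp: pay_def payoff_def reach_def)
qed (use H in \<open>auto simp: pay_def payoff_def exits_def\<close>)

lemma integrable_val: "integrable M (val n)"
proof -
  obtain C where "0 \<le> C"
    and C: "\<And>n \<omega>. \<bar>val n \<omega>\<bar> \<le> C * (1 + real n * H) * indicator {\<omega>. inside H b x (\<lambda>i. W i \<omega>) n} \<omega>"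
    using val_bounded by blast
  have "C * (1 + real n * H) * indicator {\<omega>. inside H b x (\<lambda>i. W i \<omega>) n} \<omega> \<le> C * (1 + real n * H)" for \<omega>
    using \<open>0 \<le> C\<close> H by (auto simp: indicator_def)
  then have "\<bar>val n \<omega>\<bar> \<le> C * (1 + real n * H)" for \<omega>
    using C[of n \<omega>] order_trans by blast
  then show ?thesis by (intro integrable_const_bound[where B="C * (1 + real n * H)"]) auto
qed

lemma integrable_pay: "integrable M (pay n)"
  using pay_bounded by (intro integrable_const_bound[where B="real n * H + H"]) auto

text \<open>Averaging over the next move with the first \<open>n\<close> moves held fixed reproduces
  the current value, by \<open>step_mean\<close>.\<close>

lemma val_step: "expectation (val n) = expectation (val (Suc n)) + expectation (pay n)"
proof -
  let ?up = "up_move b n"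
  define X where "X = (\<lambda>\<omega>. restrict (\<lambda>i. W i \<omega>) {..<n})"
  define Z where "Z = (\<lambda>\<omega>. restrict (\<lambda>i. W i \<omega>) {n})"
  define f where "f v u = (if inside H b x v n then step ?up (pos b x v n) (elapsed v n) (u n) else 0)"
    for v u :: "nat \<Rightarrow> real"
  \<comment> \<open>As directions alternate, the yield of move \<open>n\<close> splits into the
    surviving part \<open>val (Suc n)\<close> and the exit part \<open>pay n\<close>.\<close>
  have f_eq: "f (X \<omega>) (Z \<omega>) = val (Suc n) \<omega> + pay n \<omega>" for \<omega>
    by (auto simp: f_def X_def Z_def val_def pay_def payoff_def exits_def inside_Suc step_def pos_Suc
        elapsed_Suc up_move_Suc)
  obtain C where C: "0 \<le> C"
    "\<And>n \<omega>. \<bar>val n \<omega>\<bar> \<le> C * (1 + real n * H) * indicator {\<omega>. inside H b x (\<lambda>i. W i \<omega>) n} \<omega>"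
    using val_bounded by blast
  have "expectation (\<lambda>\<omega>. f (X \<omega>) (Z \<omega>)) = expectation (val n)"
  proof (rule expectation_indep_var[where f=f and X=X and Z=Z])
    show "indep_var (past n) X (PiM {n} (\<lambda>_. borel)) Z"
      unfolding X_def Z_def by (rule indep_past)
    show "(\<lambda>z. f (fst z) (snd z)) \<in> borel_measurable (past n \<Otimes>\<^sub>M PiM {n} (\<lambda>_. borel))"
      unfolding f_def
    proof (intro measurable_If measurable_step predE)
      show "(\<lambda>z. snd z n) \<in> borel_measurable (past n \<Otimes>\<^sub>M PiM {n} (\<lambda>_. borel))"
        by (rule measurable_compose[OF measurable_snd measurable_component_singleton]) simp
    qed (use measurable_compose[OF measurable_fst measurable_pos_past[OF order_refl]]
        measurable_compose[OF measurable_fst measurable_elapsed_past]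
        measurable_compose[OF measurable_fst measurable_inside_past] in auto)
    fix \<omega>
    have "C * (1 + real (Suc n) * H) * indicator {\<omega>. inside H b x (\<lambda>i. W i \<omega>) (Suc n)} \<omega>
        \<le> C * (1 + real (Suc n) * H)"
      using C(1) H by (auto simp: indicator_def)
    with C(2)[of "Suc n" \<omega>] pay_bounded[of n \<omega>]
    show "\<bar>f (X \<omega>) (Z \<omega>)\<bar> \<le> C * (1 + real (Suc n) * H) + (real n * H + H)"
      unfolding f_eq by linarith
    show "expectation (\<lambda>\<omega>'. f (X \<omega>) (Z \<omega>')) = val n \<omega>"
    proof (cases "inside H b x (\<lambda>i. W i \<omega>) n")
      case True
      let ?g = "step ?up (pos b x (\<lambda>i. W i \<omega>) n) (elapsed (\<lambda>i. W i \<omega>) n)"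
      have "expectation (\<lambda>\<omega>'. ?g (W n \<omega>'))
          = integral\<^sup>L (density lborel (exponential_density (if ?up then lam else mu))) ?g"
        unfolding distributed_distr_eq_density[OF law[of n], symmetric]
        by (subst integral_distr) auto
      then show ?thesis
        using True step_mean[OF rates inside_pos[OF start True], of ?up]
        by (simp add: f_def X_def Z_def val_def has_bochner_integral_iff)
    qed (simp add: f_def X_def val_def)
  qed
  then show ?thesis
    using integrable_val integrable_pay by (simp add: f_eq)
qed

text \<open>The bound is of order \<open>n * q ^ n\<close> with \<open>q < 1\<close>.\<close>

lemma val_tendsto_0: "(\<lambda>n. expectation (val n)) \<longlonglongrightarrow> 0"
proof -
  obtain C where C: "0 \<le> C"
    "\<And>n \<omega>. \<bar>val n \<omega>\<bar> \<le> C * (1 + real n * H) * indicator {\<omega>. inside H b x (\<lambda>i. W i \<omega>) n} \<omega>"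
    using val_bounded by blast
  let ?q = "1 - exp (- H * max lam mu)"
  have q: "0 \<le> ?q" "\<bar>?q\<bar> < 1" using H rates by auto
  have "norm (expectation (val n)) \<le> C * (1 + real n * H) * ?q ^ n" for n
  proof -
    let ?I = "{\<omega>\<in>space M. inside H b x (\<lambda>i. W i \<omega>) n}"
    have "norm (expectation (val n)) \<le> expectation (\<lambda>\<omega>. norm (val n \<omega>))"
      by (rule integral_norm_bound)
    also have "\<dots> \<le> expectation (\<lambda>\<omega>. C * (1 + real n * H) * indicator ?I \<omega>)"
    proof (rule integral_mono)
      show "integrable M (\<lambda>\<omega>. C * (1 + real n * H) * indicator ?I \<omega>)"
        by (intro integrable_mult_right integrable_real_indicator) (auto simp: emeasure_eq_measure)
      show "norm (val n \<omega>) \<le> C * (1 + real n * H) * indicator ?I \<omega>" if "\<omega> \<in> space M" for \<omega>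
        using C(2)[of n \<omega>] that by (simp add: indicator_def)
    qed (use integrable_val in simp)
    also have "\<dots> = C * (1 + real n * H) * prob ?I"
      by simp
    also have "\<dots> \<le> C * (1 + real n * H) * ?q ^ n"
      using prob_inside_le[OF H start, of n] C(1) H by (intro mult_left_mono) auto
    finally show ?thesis .
  qed
  moreover have "(\<lambda>n. C * (1 + real n * H) * ?q ^ n) \<longlonglongrightarrow> 0"
  proof -
    have "(\<lambda>n. C * ?q ^ n + C * H * (real n * ?q ^ n)) \<longlonglongrightarrow> C * 0 + C * H * 0"
      using q by (intro tendsto_intros LIMSEQ_realpow_zero powser_times_n_limit_0) auto
    then show ?thesis by (simp add: algebra_simps)
  qed
  ultimately show ?thesis by (rule Lim_null_comparison[OF always_eventually[OF allI]])
qed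

text \<open>Telescoping \<open>val_step\<close> from clock \<open>0\<close>, where \<open>V\<close>
  equals \<open>m\<close>, gives the partial sums of the mean payoffs; the remainder vanishes by
  \<open>val_tendsto_0\<close>. Nonnegativity of \<open>m b x\<close> follows from this
  representation, without inspecting any closed formula.\<close>

lemma nn_integral_payoff:
  "(\<integral>\<^sup>+\<omega>. (\<Sum>n. ennreal (payoff H atH b x (\<lambda>i. W i \<omega>) n)) \<partial>M) = ennreal (m b x)"
  and m_nonneg: "0 \<le> m b x"
proof -
  have AE_pay: "AE \<omega> in M. 0 \<le> pay n \<omega>" for n
    using AE_W_pos by eventually_elim (simp add: pay_def payoff_nonneg[OF start])
  have "(\<Sum>k<n. expectation (pay k)) = m b x - expectation (val n)" for n
  proof (induction n)
    case 0
    have "val 0 \<omega> = m b x" for \<omega>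
      by (simp add: val_def inside_def V_def elapsed_def pos_def up_move_def)
    then show ?case by (simp add: prob_space)
  next
    case (Suc n)
    then show ?case using val_step[of n] by simp
  qed
  then have sums: "(\<lambda>k. expectation (pay k)) sums m b x"
    using tendsto_diff[OF tendsto_const[of "m b x"] val_tendsto_0] by (simp add: sums_def)
  have nonneg: "0 \<le> expectation (pay k)" for k
    using AE_pay by (rule integral_nonneg_AE)
  show "0 \<le> m b x"
    using suminf_nonneg[OF sums_summable[OF sums] nonneg] sums_unique[OF sums] by simp
  have "(\<integral>\<^sup>+\<omega>. (\<Sum>n. ennreal (pay n \<omega>)) \<partial>M) = (\<Sum>n. \<integral>\<^sup>+\<omega>. ennreal (pay n \<omega>) \<partial>M)"
    by (rule nn_integral_suminf) simp
  also have "\<dots> = (\<Sum>n. ennreal (expectation (pay n)))"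
    by (simp add: nn_integral_eq_integral[OF integrable_pay AE_pay])
  also have "\<dots> = ennreal (m b x)"
    using suminf_ennreal2[OF nonneg sums_summable[OF sums]] sums_unique[OF sums] by simp
  finally show "(\<integral>\<^sup>+\<omega>. (\<Sum>n. ennreal (payoff H atH b x (\<lambda>i. W i \<omega>) n)) \<partial>M) = ennreal (m b x)"
    by (simp add: pay_def)
qed

end

lemma (in alternating_moves) has_mean_payoff:
  assumes "exit_values lam mu H atH p m" and x: "0 \<le> x" "x \<le> H"
    and X: "AE \<omega> in M. \<forall>n. exits H b x (\<lambda>i. W i \<omega>) n \<longrightarrow> X \<omega> = ennreal (payoff H atH b x (\<lambda>i. W i \<omega>) n)"
  shows "has_mean M X (m b x)"
proof -
  interpret exit_values lam mu H atH p m by fact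
  interpret exit_problem M W b lam mu H atH p m x by unfold_locales fact+
  have "AE \<omega> in M. X \<omega> = (\<Sum>n. ennreal (payoff H atH b x (\<lambda>i. W i \<omega>) n))"
    using X AE_exits[OF H start] by eventually_elim (auto simp: payoff_suminf)
  then show ?thesis
    by (intro has_mean_AE_suminf[where f="\<lambda>n \<omega>. payoff H atH b x (\<lambda>i. W i \<omega>) n"]
        nn_integral_payoff m_nonneg measurable_payoff)
qed

section \<open>Boundary hitting times of a sample path\<close>

definition interleave :: "(nat \<Rightarrow> real) \<Rightarrow> (nat \<Rightarrow> real) \<Rightarrow> nat \<Rightarrow> real" where
  "interleave u d k = (if even k then u (k div 2) else d (k div 2))"

lemma pos_interleave_even:
  "pos True x (interleave u d) (2 * j) = x + (\<Sum>i<j. u i) - (\<Sum>i<j. d i)"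
  by (induction j) (auto simp: pos_def interleave_def up_move_def)

lemma pos_interleave_odd:
  "pos True x (interleave u d) (Suc (2 * j)) = x + (\<Sum>i<Suc j. u i) - (\<Sum>i<j. d i)"
  by (simp add: pos_Suc pos_interleave_even shift_def up_move_def interleave_def)

lemma elapsed_interleave_even: "elapsed (interleave u d) (2 * j) = (\<Sum>i<j. u i) + (\<Sum>i<j. d i)"
  by (induction j) (auto simp: elapsed_def interleave_def)

lemma elapsed_interleave_odd:
  "elapsed (interleave u d) (Suc (2 * j)) = (\<Sum>i<Suc j. u i) + (\<Sum>i<j. d i)"
  by (simp add: elapsed_Suc elapsed_interleave_even interleave_def)

lemma inside_interleaveD:
  assumes "inside H True x (interleave u d) n"
  shows "2 * i < n \<Longrightarrow> x + (\<Sum>k<Suc i. u k) - (\<Sum>k<i. d k) \<le> H"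
    and "Suc (2 * i) < n \<Longrightarrow> 0 < x + (\<Sum>k<Suc i. u k) - (\<Sum>k<Suc i. d k)"
proof -
  show "x + (\<Sum>k<Suc i. u k) - (\<Sum>k<i. d k) \<le> H" if "2 * i < n"
  proof -
    have "stays H (up_move True (2 * i)) (pos True x (interleave u d) (Suc (2 * i)))"
      using assms that unfolding inside_def by blast
    then show ?thesis unfolding pos_interleave_odd stays_def by simp
  qed
  show "0 < x + (\<Sum>k<Suc i. u k) - (\<Sum>k<Suc i. d k)" if "Suc (2 * i) < n"
  proof -
    have "stays H (up_move True (Suc (2 * i))) (pos True x (interleave u d) (2 * Suc i))"
      using assms that unfolding inside_def by force
    then show ?thesis unfolding pos_interleave_even stays_def by (simp add: up_move_def)
  qed
qed

lemma two_times_ennreal: "0 \<le> t \<Longrightarrow> 2 * ennreal t = ennreal (2 * t)"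
  by (simp add: ennreal_mult)

lemma ennreal_le_Inf: "(\<And>t. t \<in> A \<Longrightarrow> c \<le> t) \<Longrightarrow> ennreal c \<le> Inf (ennreal ` A)"
  by (auto intro!: INF_greatest ennreal_leI)

locale sample_path =
  fixes u d :: "nat \<Rightarrow> real"
  assumes u_pos: "\<And>i. 0 < u i" and d_pos: "\<And>i. 0 < d i"
begin

abbreviation S :: "nat \<Rightarrow> real" where "S n \<equiv> \<Sum>i<n. u i"
abbreviation R :: "nat \<Rightarrow> real" where "R n \<equiv> \<Sum>i<n. d i"

lemma strict_mono_S: "strict_mono S"
  by (rule strict_monoI_Suc) (simp add: u_pos)

lemma S_nonneg: "0 \<le> S n"
  by (intro sum_nonneg less_imp_le u_pos)

lemma R_nonneg: "0 \<le> R n"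
  by (intro sum_nonneg less_imp_le d_pos)

text \<open>Strict growth of \<open>S\<close> makes the set inside \<open>N\<close> equal to
  \<open>{..n}\<close>, so its \<open>Max\<close> is meaningful on these paths.\<close>

lemma Y_eq:
  assumes "S n \<le> t" "t < S (Suc n)"
  shows "Y u d t = R n"
proof -
  have "{k. S k \<le> t} = {..n}"
  proof safe
    fix k assume "S k \<le> t"
    with assms have "S k < S (Suc n)" by linarith
    then have "k < Suc n" using strict_mono_less[OF strict_mono_S, of k "Suc n"] by blast
    then show "k \<le> n" by simp
  next
    fix k assume "k \<le> n"
    then have "S k \<le> S n" using strict_mono_less_eq[OF strict_mono_S, of k n] by blast
    with assms show "S k \<le> t" by linarith
  qed
  moreover have "Max {..n} = n" by (rule Max_eqI) auto
  ultimately have "N u t = n" by (simp add: N_def)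
  then show ?thesis by (simp add: Y_def)
qed

lemma Y_nonneg: "0 \<le> Y u d t"
  unfolding Y_def by (rule R_nonneg)

lemma Y_cases:
  assumes "0 \<le> t" "t < S k"
  obtains i where "i < k" "S i \<le> t" "t < S (Suc i)" "Y u d t = R i"
proof -
  have "\<exists>i<k. S i \<le> t \<and> t < S (Suc i)"
    using assms(2)
  proof (induction k)
    case (Suc k)
    show ?case
    proof (cases "t < S k")
      case True
      with Suc.IH show ?thesis by (meson less_SucI)
    qed (use Suc.prems in auto)
  qed (use assms(1) in auto)
  then show ?thesis using that Y_eq by blast
qed

text \<open>On \<open>[S i, S (Suc i))\<close> the function \<open>Y\<close> is constant, so
  \<open>y + R i\<close> is the only candidate there. By \<open>below\<close> it lies at or past the
  excluded right end for \<open>i < j\<close>; by \<open>above\<close> it falls inside the interval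
  for \<open>i = j\<close>.\<close>

lemma THH_eq:
  assumes y: "0 \<le> y" and below: "\<And>i. i < j \<Longrightarrow> S (Suc i) \<le> y + R i" and above: "y + R j < S (Suc j)"
  shows "THH u d y = ennreal (y + R j)"
proof (rule antisym)
  have "S j \<le> y + R j"
  proof (cases j)
    case (Suc i)
    then show ?thesis using below[of i] d_pos[of i] by simp
  qed (use y in simp)
  then have "Y u d (y + R j) = R j" using above by (rule Y_eq)
  then show "THH u d y \<le> ennreal (y + R j)"
    unfolding THH_def using y R_nonneg[of j] by (intro INF_lower) auto
  show "ennreal (y + R j) \<le> THH u d y"
    unfolding THH_def
  proof (rule ennreal_le_Inf, rule ccontr)
    fix t assume t: "t \<in> {t. 0 \<le> t \<and> Y u d t = t - y}" "\<not> y + R j \<le> t"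
    with above have "t < S (Suc j)" by linarith
    with t obtain i where i: "i < Suc j" "S i \<le> t" "t < S (Suc i)" "Y u d t = R i"
      using Y_cases[of t "Suc j"] by blast
    then have "t = y + R i" using t by simp
    moreover from this t have "i \<noteq> j" by auto
    ultimately show False using below[of i] i by linarith
  qed
qed

text \<open>The candidates before jump \<open>k\<close> are excluded as in \<open>THH_eq\<close>,
  and the next one, \<open>y + R k\<close>, exceeds \<open>S k\<close> strictly because the last
  jump is positive.\<close>

lemma THH_gt:
  assumes y: "0 < y" and below: "\<And>i. i < k \<Longrightarrow> S (Suc i) \<le> y + R i"
  shows "ennreal (S k) < THH u d y"
proof -
  have "S k < y + R k"
  proof (cases k)
    case (Suc i)
    then show ?thesis using below[of i] d_pos[of i] by simp
  qed (use y in simp)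
  moreover have "S k < S (Suc k)" by (simp add: u_pos)
  ultimately have "ennreal (S k) < ennreal (min (S (Suc k)) (y + R k))"
    by (intro ennreal_lessI) (use S_nonneg[of k] in linarith)+
  also have "\<dots> \<le> THH u d y"
    unfolding THH_def
  proof (rule ennreal_le_Inf, rule ccontr)
    fix t assume t: "t \<in> {t. 0 \<le> t \<and> Y u d t = t - y}" "\<not> min (S (Suc k)) (y + R k) \<le> t"
    then have "t < S (Suc k)" by linarith
    with t obtain i where i: "i < Suc k" "S i \<le> t" "t < S (Suc i)" "Y u d t = R i"
      using Y_cases[of t "Suc k"] by blast
    then have "t = y + R i" using t by simp
    moreover from this t have "i \<noteq> k" by auto
    ultimately show False using below[of i] i by linarith
  qed
  finally show ?thesis .
qed

text \<open>Between jumps \<open>t + c\<close> grows while \<open>Y\<close> is constant, so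
  \<open>t + c \<le> Y\<close> can first become true only at a jump. Before the first jump
  \<open>Y\<close> is \<open>0\<close>, which \<open>0 < t + c\<close> rules out.\<close>

lemma bottom_ge:
  assumes A: "\<And>t. t \<in> A \<Longrightarrow> 0 \<le> t \<and> t + c \<le> Y u d t \<and> 0 < t + c"
    and above: "\<And>i. 0 < i \<Longrightarrow> i < k \<Longrightarrow> R i < c + S i"
  shows "ennreal (S k) \<le> Inf (ennreal ` A)"
proof (rule ennreal_le_Inf, rule ccontr)
  fix t assume t: "t \<in> A" "\<not> S k \<le> t"
  then have "0 \<le> t" "t < S k" using A by auto
  then obtain i where i: "i < k" "S i \<le> t" "t < S (Suc i)" "Y u d t = R i"
    by (rule Y_cases)
  show False
  proof (cases "i = 0")
    case True
    then show ?thesis using A[OF t(1)] i(4) by auto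
  next
    case False
    then have "R i < c + S i" using above i(1) by blast
    then show ?thesis using A[OF t(1)] i by linarith
  qed
qed

lemma bottom_eq:
  assumes A: "\<And>t. t \<in> A \<Longrightarrow> 0 \<le> t \<and> t + c \<le> Y u d t \<and> 0 < t + c"
    "\<And>t. 0 < t \<Longrightarrow> t + c \<le> Y u d t \<Longrightarrow> t \<in> A"
    and above: "\<And>i. 0 < i \<Longrightarrow> i < k \<Longrightarrow> R i < c + S i"
    and k: "0 < k" and hit: "c + S k \<le> R k"
  shows "Inf (ennreal ` A) = ennreal (S k)"
proof (rule antisym)
  have "Y u d (S k) = R k" by (rule Y_eq) (simp_all add: u_pos)
  moreover have "0 < S k" using strict_monoD[OF strict_mono_S k] by simp
  ultimately show "Inf (ennreal ` A) \<le> ennreal (S k)"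
    using A(2)[of "S k"] hit by (intro INF_lower) simp
  show "ennreal (S k) \<le> Inf (ennreal ` A)"
    using A(1) above by (rule bottom_ge)
qed

text \<open>
  The set \<open>A\<close> covers \<^const>\<open>T00\<close> (with \<open>y = H\<close>, where \<open>t = 0\<close> is excluded) and \<^const>\<open>TH0\<close> at once.
\<close>

lemma exit_times:
  assumes y: "0 < y"
    and A: "\<And>t. t \<in> A \<Longrightarrow> 0 \<le> t \<and> t + (H - y) \<le> Y u d t \<and> 0 < t + (H - y)"
      "\<And>t. 0 < t \<Longrightarrow> t + (H - y) \<le> Y u d t \<Longrightarrow> t \<in> A"
    and ex: "exits H True (H - y) (interleave u d) n"
  obtains \<tau> where "y \<le> \<tau>" "even n" "THH u d y = ennreal \<tau>" "THH u d y < Inf (ennreal ` A)"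
      "elapsed (interleave u d) n + reach H True (pos True (H - y) (interleave u d) n) = 2 * \<tau> - y"
    | \<tau> where "0 \<le> \<tau>" "odd n" "Inf (ennreal ` A) = ennreal \<tau>" "Inf (ennreal ` A) < THH u d y"
      "elapsed (interleave u d) n + reach H False (pos True (H - y) (interleave u d) n) = 2 * \<tau> + (H - y)"
proof (cases "even n")
  case True
  then obtain j where n: "n = 2 * j" by blast
  have "inside H True (H - y) (interleave u d) n"
    and lv: "H < H - y + S (Suc j) - R j"
    using ex unfolding exits_def n pos_interleave_odd leaves_def by (simp_all add: up_move_def)
  note ins = inside_interleaveD[OF this(1), unfolded n]
  have T: "THH u d y = ennreal (y + R j)"
  proof (rule THH_eq)
    show "S (Suc i) \<le> y + R i" if "i < j" for i using ins(1)[of i] that by simp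
  qed (use y lv in linarith)+
  \<comment> \<open>The time of \<open>Y\<close> counts upward motion only, jumps being descents.
    Exit at the top thus precedes jump \<open>Suc j\<close>, and upward time \<open>\<tau>\<close>
    comes with downward time \<open>\<tau> - y\<close>, in total
    \<open>2 * \<tau> - y\<close>.\<close>
  have "ennreal (y + R j) < ennreal (S (Suc j))"
    by (intro ennreal_lessI) (use lv y R_nonneg[of j] in linarith)+
  also have "\<dots> \<le> Inf (ennreal ` A)"
  proof (rule bottom_ge[OF A(1)])
    fix i assume i: "0 < i" "i < Suc j"
    then obtain i' where "i = Suc i'" by (cases i) auto
    with i show "R i < H - y + S i" using ins(2)[of i'] by simp
  qed
  finally have "THH u d y < Inf (ennreal ` A)" by (simp only: T)
  then show ?thesis
    using True T R_nonneg[of j]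
    by (intro that(1)[of "y + R j"])
      (simp_all only: n elapsed_interleave_even pos_interleave_even reach_def, simp_all)
next
  case False
  then obtain j where n: "n = Suc (2 * j)" by (metis oddE Suc_eq_plus1)
  have "inside H True (H - y) (interleave u d) n"
    and lv: "H - y + S (Suc j) - R (Suc j) \<le> 0"
    using ex pos_interleave_even[of "H - y" u d "Suc j"] unfolding exits_def n leaves_def
    by (simp_all add: up_move_def)
  note ins = inside_interleaveD[OF this(1), unfolded n]
  \<comment> \<open>Exit at the bottom occurs during the descent that \<open>Y\<close> performs as
    jump \<open>Suc j\<close>; the descending distance actually covered is
    \<open>\<tau> + (H - y)\<close>.\<close>
  have T: "Inf (ennreal ` A) = ennreal (S (Suc j))"
  proof (rule bottom_eq[OF A])
    fix i assume i: "0 < i" "i < Suc j"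
    then obtain i' where "i = Suc i'" by (cases i) auto
    with i show "R i < H - y + S i" using ins(2)[of i'] by simp
  qed (use lv in \<open>auto simp: algebra_simps\<close>)
  have "ennreal (S (Suc j)) < THH u d y"
  proof (rule THH_gt[OF y])
    show "S (Suc i) \<le> y + R i" if "i < Suc j" for i using ins(1)[of i] that by simp
  qed
  then have "Inf (ennreal ` A) < THH u d y" by (simp only: T)
  then show ?thesis
    using False T S_nonneg[of "Suc j"]
    by (intro that(2)[of "S (Suc j)"])
      (simp_all only: n elapsed_interleave_odd pos_interleave_odd reach_def, simp_all)
qed

text \<open>Nonnegativity of \<open>Y\<close> enforces \<open>H \<le> t\<close>. A start at
  \<open>0\<close> is thereby treated as a start at \<open>H\<close> after an initial descent of
  exactly \<open>H\<close>.\<close>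

lemma T0H_eq_THH: "0 < H \<Longrightarrow> T0H H u d = THH u d H"
proof -
  assume "0 < H"
  have "H \<le> t \<and> Y u d t = t - H \<longleftrightarrow> 0 \<le> t \<and> Y u d t = t - H" for t
    using Y_nonneg[of t] \<open>0 < H\<close> by linarith
  then show ?thesis by (simp add: T0H_def THH_def)
qed

lemma C0_eq_payoff:
  assumes H: "0 < H" and ex: "exits H True 0 (interleave u d) n"
  shows "C00 H u d = ennreal (payoff H False True 0 (interleave u d) n)"
    and "C0H H u d = ennreal (payoff H True True 0 (interleave u d) n)"
proof -
  let ?A = "{t. 0 < t \<and> t \<le> Y u d t}"
  have up: "up_move True n \<longleftrightarrow> even n" by (simp add: up_move_def)
  have "exits H True (H - H) (interleave u d) n" using ex by simp
  then have "C00 H u d = ennreal (payoff H False True 0 (interleave u d) n) \<and>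
      C0H H u d = ennreal (payoff H True True 0 (interleave u d) n)"
  proof (rule exit_times[of H ?A, rotated 3])
    fix \<tau> assume \<tau>: "H \<le> \<tau>" "even n" "THH u d H = ennreal \<tau>" "THH u d H < Inf (ennreal ` ?A)"
      "elapsed (interleave u d) n + reach H True (pos True (H - H) (interleave u d) n) = 2 * \<tau> - H"
    have "2 * ennreal \<tau> - ennreal H = ennreal (2 * \<tau> - H)"
      using \<tau>(1) H by (simp add: two_times_ennreal ennreal_minus)
    then show ?thesis using \<tau> ex
      by (auto simp: C00_def C0H_def T0_star_def T0H_eq_THH[OF H] T00_def payoff_def up min_def)
  next
    fix \<tau> assume \<tau>: "0 \<le> \<tau>" "odd n" "Inf (ennreal ` ?A) = ennreal \<tau>" "Inf (ennreal ` ?A) < THH u d H"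
      "elapsed (interleave u d) n + reach H False (pos True (H - H) (interleave u d) n) = 2 * \<tau> + (H - H)"
    have "2 * ennreal \<tau> = ennreal (2 * \<tau>)"
      using \<tau>(1) by (rule two_times_ennreal)
    then show ?thesis using \<tau> ex
      by (auto simp: C00_def C0H_def T0_star_def T0H_eq_THH[OF H] T00_def payoff_def up min_def)
  qed (use H in auto)
  then show "C00 H u d = ennreal (payoff H False True 0 (interleave u d) n)"
    and "C0H H u d = ennreal (payoff H True True 0 (interleave u d) n)" by auto
qed

end

section \<open>Paths preceded by an initial descent\<close>

lemma pos_case_nat: "pos False x (case_nat y w) (Suc n) = pos True (x - y) w n"
  unfolding pos_def sum.lessThan_Suc_shift by (simp add: up_move_def cong: if_cong)

lemma elapsed_case_nat: "elapsed (case_nat y w) (Suc n) = y + elapsed w n"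
  unfolding elapsed_def sum.lessThan_Suc_shift by simp

lemma inside_case_nat:
  "inside H False x (case_nat y w) (Suc n) \<longleftrightarrow>
    stays H False (x - y) \<and> inside H True (x - y) w n"
  by (auto simp: inside_def pos_case_nat less_Suc_eq_0_disj up_move_def)
    (auto simp: pos_case_nat pos_def)

text \<open>Dropping the initial descent flips the parity of the moves, so what remains is an
  upward-first path from \<open>x - y\<close>.\<close>

lemma exits_case_nat:
  "exits H False x (case_nat y w) (Suc n) \<longleftrightarrow>
    stays H False (x - y) \<and> exits H True (x - y) w n"
  by (auto simp: exits_def inside_case_nat pos_case_nat up_move_def)

context sample_path
begin

lemma CH_eq_payoff:
  assumes H: "0 < H" and y: "0 < y"
    and ex: "exits H False H (case_nat y (interleave u d)) n"
  shows "CH0 H u d y = ennreal (payoff H False False H (case_nat y (interleave u d)) n)"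
    and "CHH H u d y = ennreal (payoff H True False H (case_nat y (interleave u d)) n)"
proof -
  let ?w = "case_nat y (interleave u d)"
  let ?A = "{t. 0 \<le> t \<and> t - y + H \<le> Y u d t}"
  have "CH0 H u d y = ennreal (payoff H False False H ?w n) \<and>
      CHH H u d y = ennreal (payoff H True False H ?w n)"
  proof (cases n)
    case 0
    \<comment> \<open>The initial descent itself reaches the bottom. Then \<open>t = 0\<close>
      already qualifies for \<open>TH0\<close>, and the cycle lasts \<open>H\<close>.\<close>
    then have Hy: "H \<le> y" using ex
      by (auto simp: exits_def leaves_def up_move_def pos_case_nat pos_def)
    have "Y u d 0 = 0" using Y_eq[of 0 0] by (simp add: u_pos)
    then have "TH0 H u d y \<le> ennreal 0"
      unfolding TH0_def using Hy by (intro INF_lower) auto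
    then have T: "TH0 H u d y = 0" by simp
    have "THH u d y > 0" using THH_gt[OF y, of 0] by simp
    then show ?thesis using ex 0 T
      by (auto simp: CH0_def CHH_def TH_star_def payoff_def up_move_def min_def
          elapsed_def reach_def pos_def)
  next
    case (Suc k)
    \<comment> \<open>Otherwise the initial descent survives, and its length \<open>y\<close>
      completes the elapsed times of \<open>exit_times\<close> to \<open>2 * \<tau>\<close> and
      \<open>2 * \<tau> + H\<close>.\<close>
    have up: "up_move False n \<longleftrightarrow> even k" by (simp add: up_move_def Suc)
    have Hy: "y < H" and ex': "exits H True (H - y) (interleave u d) k"
      using ex by (auto simp: Suc exits_case_nat stays_def)
    from ex' show ?thesis
    proof (rule exit_times[of y ?A, rotated 3])
      fix \<tau> assume \<tau>: "y \<le> \<tau>" "even k" "THH u d y = ennreal \<tau>" "THH u d y < Inf (ennreal ` ?A)"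
        "elapsed (interleave u d) k + reach H True (pos True (H - y) (interleave u d) k) = 2 * \<tau> - y"
      have "2 * ennreal \<tau> = ennreal (2 * \<tau>)"
        using \<tau>(1) y by (intro two_times_ennreal) simp
      moreover have "payoff H True False H ?w n = 2 * \<tau>" "payoff H False False H ?w n = 0"
        using \<tau> ex unfolding payoff_def up by (simp_all add: Suc elapsed_case_nat pos_case_nat)
      ultimately show ?thesis using \<tau>(3,4)
        by (auto simp: CH0_def CHH_def TH_star_def TH0_def min_def)
    next
      fix \<tau> assume \<tau>: "0 \<le> \<tau>" "odd k" "Inf (ennreal ` ?A) = ennreal \<tau>" "Inf (ennreal ` ?A) < THH u d y"
        "elapsed (interleave u d) k + reach H False (pos True (H - y) (interleave u d) k) = 2 * \<tau> + (H - y)"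
      have "2 * ennreal \<tau> + ennreal H = ennreal (2 * \<tau> + H)"
        using \<tau>(1) H by (simp add: two_times_ennreal)
      moreover have "payoff H True False H ?w n = 0" "payoff H False False H ?w n = 2 * \<tau> + H"
        using \<tau> ex unfolding payoff_def up by (simp_all add: Suc elapsed_case_nat pos_case_nat)
      ultimately show ?thesis using \<tau>(3,4)
        by (auto simp: CH0_def CHH_def TH_star_def TH0_def min_def)
    qed (use y Hy in auto)
  qed
  then show "CH0 H u d y = ennreal (payoff H False False H ?w n)"
    and "CHH H u d y = ennreal (payoff H True False H ?w n)" by auto
qed

end

section \<open>Explicit value functions\<close>

text \<open>The mean of \<open>C00\<close>; with the rates exchanged, by reflection, that of
  \<open>CHH\<close>. The formula for different rates degenerates to \<open>0 / 0\<close> at equal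
  rates.\<close>

definition mean_00 :: "real \<Rightarrow> real \<Rightarrow> real \<Rightarrow> real" where
  "mean_00 lam mu H =
    (if lam = mu then mu * H\<^sup>2 * (3 + 2 * mu * H) / (3 * (1 + mu * H)\<^sup>2)
     else 2 * lam * (lam - mu * exp (2 * H * (mu - lam))
         + (mu - lam) * exp (H * (mu - lam)) * (1 + H * (lam + mu)))
       / ((lam - mu) * (lam - mu * exp (H * (mu - lam)))\<^sup>2))"

text \<open>The mean of \<open>CH0\<close>; with the rates exchanged, that of
  \<open>C0H\<close>.\<close>

definition mean_H0 :: "real \<Rightarrow> real \<Rightarrow> real \<Rightarrow> real" where
  "mean_H0 lam mu H =
    (if lam = mu then H * (3 + 3 * mu * H + mu\<^sup>2 * H\<^sup>2) / (3 * (1 + mu * H)\<^sup>2)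
     else (mu * exp (H * (lam - mu)) * (lam * (4 + lam * H) - mu\<^sup>2 * H)
         + lam * exp (2 * H * (lam - mu)) * (- 4 * mu + H * (lam\<^sup>2 - mu\<^sup>2)))
       / ((lam - mu) * (mu - lam * exp (H * (lam - mu)))\<^sup>2))"

lemma exp_diff_nonzero:
  assumes "0 < lam" "0 < mu" "0 < H" "lam \<noteq> (mu::real)"
  shows "lam * exp (H * (lam - mu)) - mu \<noteq> 0"
proof (cases "lam < mu")
  case True
  then have "exp (H * (lam - mu)) < 1" using assms by (simp add: mult_pos_neg)
  then have "lam * exp (H * (lam - mu)) < lam" using assms by simp
  with True show ?thesis by linarith
next
  case False
  then have "1 < exp (H * (lam - mu))" using assms by simp
  then have "lam * 1 < lam * exp (H * (lam - mu))" using assms by (intro mult_strict_left_mono) auto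
  with False show ?thesis by linarith
qed

text \<open>In terms of the single exponential \<open>F\<close> the formula is rational, so matching
  it with the value functions becomes polynomial algebra.\<close>

lemma mean_00_alt:
  assumes "lam \<noteq> mu" and F: "F = exp (H * (lam - mu))"
  shows "mean_00 lam mu H = 2 * lam * (lam * F\<^sup>2 - mu - (lam - mu) * F * (1 + H * (lam + mu)))
    / ((lam - mu) * (lam * F - mu)\<^sup>2)"
proof -
  have "F > 0" using F by simp
  have E: "exp (H * (mu - lam)) = 1 / F" "exp (2 * H * (mu - lam)) = 1 / F\<^sup>2"
    unfolding F by (simp_all add: exp_minus[symmetric] field_simps flip: exp_of_nat_mult exp_add exp_double)
  have "lam - mu * (1 / F\<^sup>2) + (mu - lam) * (1 / F) * (1 + H * (lam + mu))
    = (lam * F\<^sup>2 - mu - (lam - mu) * F * (1 + H * (lam + mu))) / F\<^sup>2"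
    using \<open>F > 0\<close> by (simp add: field_simps power2_eq_square)
  moreover have "lam - mu * (1 / F) = (lam * F - mu) / F" using \<open>F > 0\<close> by (simp add: field_simps)
  ultimately show ?thesis
    using assms(1) \<open>F > 0\<close> unfolding mean_00_def E by (simp add: power_divide)
qed

lemma mean_H0_alt:
  assumes "lam \<noteq> mu" and F: "F = exp (H * (lam - mu))"
  shows "mean_H0 lam mu H = (mu * F * (lam * (4 + lam * H) - mu\<^sup>2 * H)
         + lam * F\<^sup>2 * (- 4 * mu + H * (lam\<^sup>2 - mu\<^sup>2)))
       / ((lam - mu) * (lam * F - mu)\<^sup>2)"
proof -
  have "exp (2 * H * (lam - mu)) = F\<^sup>2" unfolding F by (simp add: mult.assoc flip: exp_double)
  then show ?thesis
    using assms(1) unfolding mean_H0_def F[symmetric] by (simp add: power2_commute)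
qed

text \<open>At equal rates \<open>p True - p False\<close> is constant, so \<open>p\<close> is
  affine, \<open>m True - m False\<close> quadratic and \<open>m\<close> cubic in
  \<open>x\<close>.\<close>

lemma exit_values_zero_eq:
  fixes lam mu H :: real
  assumes rates: "0 < lam" "0 < mu" and H: "0 < H" and eq: "lam = mu"
  obtains p m where "exit_values lam mu H False p m"
    "m True 0 = mean_00 lam mu H" "m False H = mean_H0 lam mu H"
proof -
  define g where "g = 1 + mu * H"
  have g: "g > 0" using rates H by (simp add: g_def add_pos_pos)
  \<comment> \<open>This is \<open>m True H - m False H\<close>, solved from the condition
    \<open>m False 0 = 0\<close>, which amounts to \<open>mT 0 = a + H\<close>.\<close>
  define a where "a = - ((3 * H + 3 * mu * H\<^sup>2 + mu\<^sup>2 * H ^ 3) / (3 * g\<^sup>2))"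
  define mT where "mT x = - mu * a * (H - x) - mu\<^sup>2 * (H - x) ^ 3 / (3 * g)" for x
  define p where "p up x = (if up then mu * (H - x) / g else (1 + mu * (H - x)) / g)" for up x
  define m where "m up x = (if up then mT x else mT x - a - (mu * (H - x)\<^sup>2 + (H - x)) / g)" for up x
  have mT0: "mT 0 = a + H"
    using g unfolding mT_def a_def
    by (simp add: divide_simps) (simp add: g_def algebra_simps power2_eq_square power3_eq_cube)
  have "exit_values lam mu H False p m"
  proof
    show "(p True has_real_derivative lam * (p True x - p False x)) (at x)" for x
      unfolding p_def using g eq by (auto intro!: derivative_eq_intros simp: divide_simps)
    show "(p False has_real_derivative mu * (p True x - p False x)) (at x)" for x
      unfolding p_def using g eq by (auto intro!: derivative_eq_intros simp: divide_simps)
    have mT: "(mT has_real_derivative mu * a + mu\<^sup>2 * (H - x)\<^sup>2 / g) (at x)" for x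
      unfolding mT_def using g
      by (auto intro!: derivative_eq_intros simp: divide_simps)
    have m: "m True = mT" "m False = (\<lambda>x. mT x - a - (mu * (H - x)\<^sup>2 + (H - x)) / g)"
      by (simp_all add: m_def fun_eq_iff)
    have q: "((\<lambda>x. a + (mu * (H - x)\<^sup>2 + (H - x)) / g) has_real_derivative
        - (2 * mu * (H - x) + 1) / g) (at x)" for x
      using g by (auto intro!: derivative_eq_intros simp: divide_simps algebra_simps)
    show "(m True has_real_derivative lam * (m True x - m False x) - p True x) (at x)" for x
      unfolding m using mT[of x]
      by (rule DERIV_cong) (use g in \<open>simp add: p_def eq field_simps power2_eq_square\<close>)
    show "(m False has_real_derivative mu * (m True x - m False x) + p False x) (at x)" for x
      unfolding m diff_diff_eq using DERIV_diff[OF mT[of x] q[of x]]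
      by (rule DERIV_cong) (use g in \<open>simp add: p_def eq field_simps power2_eq_square\<close>)
    show "p False 0 = (if False then 0 else 1)" using g by (simp add: p_def g_def)
    show "m False 0 = 0"
      using g mT0 by (simp add: m_def divide_simps) (simp add: g_def algebra_simps power2_eq_square)
  qed (use H in \<open>auto simp: p_def m_def mT_def\<close>)
  moreover have "m True 0 = mean_00 lam mu H"
    using g eq unfolding m_def mT0 mean_00_def g_def[symmetric] a_def
    by (simp add: divide_simps) (simp add: g_def algebra_simps power2_eq_square power3_eq_cube)
  moreover have "m False H = mean_H0 lam mu H"
    using eq unfolding m_def mT_def mean_H0_def g_def[symmetric] a_def
    by (simp add: algebra_simps power2_eq_square power3_eq_cube)
  ultimately show ?thesis by (rule that)
qed

lemma exit_values_zero_neq: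
  fixes lam mu H :: real
  assumes rates: "0 < lam" "0 < mu" and H: "0 < H" and neq: "lam \<noteq> mu"
  obtains p m where "exit_values lam mu H False p m"
    "m True 0 = mean_00 lam mu H" "m False H = mean_H0 lam mu H"
proof -
  define r where "r = lam - mu"
  define F where "F = exp (H * r)"
  \<comment> \<open>As \<open>p True - p False\<close> is a multiple of \<open>exp (r * x)\<close>,
    both \<open>p\<close> are such multiples plus a common constant; \<open>p True H = 0\<close> and
    \<open>p False 0 = 1\<close> give \<open>c\<close> and \<open>k\<close>.\<close>
  define c where "c = - 1 / (lam * F - mu)"
  define k where "k = lam * F / (lam * F - mu)"
  define a where "a = - 2 * lam / (lam * F - mu)\<^sup>2 * (F * (lam + mu) * H + (F * (lam - 2 * mu) + mu) / r)"
  define l where "l = - mu * a / r + 2 * k / r - 2 * lam * mu * c / r\<^sup>2"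
  \<comment> \<open>Replacing \<open>lam\<close> by \<open>mu + r\<close> removes the hidden
    relation among the three parameters from the polynomial identities below.\<close>
  have r: "r \<noteq> 0" and lam: "lam = mu + r" using neq by (simp_all add: r_def)
  have F: "lam * F - mu \<noteq> 0"
    using exp_diff_nonzero[OF rates H neq] by (simp add: F_def r_def)
  define p where "p up x = (if up then lam else mu) * c * exp (r * x) + k" for up x
  \<comment> \<open>\<open>n = m True - m False\<close> has to solve \<open>n' = r * n - (p True + p False)\<close>; the boundary values of
    \<open>m\<close> then determine \<open>a\<close> and \<open>l\<close>.\<close>
  define n where "n x = exp (r * x) * (a - (lam + mu) * c * x) + 2 * k / r" for x
  define mT where "mT x = lam * exp (r * x) * (a - (lam + mu) * c * x) / r
      + 2 * lam * mu * c * exp (r * x) / r\<^sup>2 + k * (lam + mu) * x / r + l" for x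
  define m where "m up x = (if up then mT x else mT x - n x)" for up x
  have n: "(n has_real_derivative r * n x - (p True x + p False x)) (at x)" for x
    unfolding n_def p_def using r
    by (auto intro!: derivative_eq_intros simp: divide_simps) (simp add: algebra_simps)
  have mT: "(mT has_real_derivative lam * n x - p True x) (at x)" for x
    unfolding n_def p_def mT_def using r
    by (auto intro!: derivative_eq_intros simp: divide_simps)
      (simp add: algebra_simps power2_eq_square lam)
  \<comment> \<open>The constant \<open>l\<close> is already fixed by \<open>m False 0 = 0\<close>;
    this is the equation that determines \<open>a\<close>.\<close>
  have mTH: "mT H = 0"
    using r F unfolding mT_def l_def a_def c_def k_def F_def[symmetric] mult.commute[of r H]
    by (simp add: divide_simps) (simp add: algebra_simps power2_eq_square lam)
  have p: "(p up has_real_derivative (if up then lam else mu) * (p True x - p False x)) (at x)" for up x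
    unfolding p_def by (auto intro!: derivative_eq_intros simp: r_def algebra_simps)
  have "exit_values lam mu H False p m"
  proof
    show "(p True has_real_derivative lam * (p True x - p False x)) (at x)" for x
      using p[of True x] by simp
    show "(p False has_real_derivative mu * (p True x - p False x)) (at x)" for x
      using p[of False x] by simp
    show "(m True has_real_derivative lam * (m True x - m False x) - p True x) (at x)" for x
      using mT[of x] unfolding m_def by simp
    show "(m False has_real_derivative mu * (m True x - m False x) + p False x) (at x)" for x
      using DERIV_diff[OF mT[of x] n[of x]] unfolding m_def by (simp add: r_def algebra_simps)
    show "p True H = (if False then 1 else 0)" "p False 0 = (if False then 0 else 1)"
      using F unfolding p_def c_def k_def mult.commute[of r H] F_def[symmetric]
      by (simp_all add: divide_simps)
    show "m True H = 0" using mTH by (simp add: m_def)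
    show "m False 0 = 0"
      using r unfolding m_def mT_def n_def l_def
      by (simp add: divide_simps) (simp add: algebra_simps power2_eq_square lam)
  qed fact
  moreover have "m True 0 = mean_00 lam mu H"
  proof -
    have m0: "m True 0 = a + 2 * k / r"
      using r unfolding m_def mT_def l_def
      by (simp add: divide_simps) (simp add: algebra_simps power2_eq_square lam)
    show ?thesis
      using r F unfolding m0 mean_00_alt[OF neq F_def[unfolded r_def]] a_def k_def r_def[symmetric]
      by (simp add: divide_simps) (simp add: algebra_simps power2_eq_square lam)
  qed
  moreover have "m False H = mean_H0 lam mu H"
    using r F unfolding mean_H0_alt[OF neq F_def[unfolded r_def]] m_def mTH n_def a_def k_def c_def
      mult.commute[of r H] F_def[symmetric] r_def[symmetric]
    by (simp add: divide_simps) (simp add: algebra_simps power2_eq_square lam)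
  ultimately show ?thesis by (rule that)
qed

lemma exit_values_zero:
  fixes lam mu H :: real
  assumes "0 < lam" "0 < mu" "0 < H"
  obtains p m where "exit_values lam mu H False p m"
    "m True 0 = mean_00 lam mu H" "m False H = mean_H0 lam mu H"
  using exit_values_zero_eq[OF assms] exit_values_zero_neq[OF assms] by blast

text \<open>The map \<open>x \<mapsto> H - x\<close> turns upward into downward moves and changes
  the sign of derivatives. It acts on the equations alone, so the asymmetric treatment of ties at
  the boundaries does not interfere.\<close>

lemma exit_values_reflect:
  assumes "exit_values lam mu H False p m"
  shows "exit_values mu lam H True (\<lambda>up x. p (\<not> up) (H - x)) (\<lambda>up x. m (\<not> up) (H - x))"
proof -
  interpret exit_values lam mu H False p m by fact
  have D: "((\<lambda>x. H - x) has_real_derivative - 1) (at x)" for x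
    by (auto intro!: derivative_eq_intros)
  show ?thesis
    using H boundary
      DERIV_chain2[OF p_up D] DERIV_chain2[OF p_down D] DERIV_chain2[OF m_up D] DERIV_chain2[OF m_down D]
    by unfold_locales (simp_all add: algebra_simps)
qed

lemma exit_values_H:
  fixes lam mu H :: real
  assumes "0 < lam" "0 < mu" "0 < H"
  obtains p m where "exit_values lam mu H True p m"
    "m True 0 = mean_H0 mu lam H" "m False H = mean_00 mu lam H"
proof -
  obtain p m where *: "exit_values mu lam H False p m"
    "m True 0 = mean_00 mu lam H" "m False H = mean_H0 mu lam H"
    using exit_values_zero[of mu lam H] assms by blast
  show ?thesis
    by (rule that[OF exit_values_reflect[OF *(1)]]) (simp_all add: *)
qed

section \<open>Closed forms of the reflected means\<close>

lemma mean_00_swap: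
  assumes "lam \<noteq> mu"
  shows "mean_00 mu lam H = 2 * mu * (lam - mu * exp (2 * H * (mu - lam))
             + (mu - lam) * exp (H * (mu - lam)) * (1 + H * (mu + lam)))
          / ((lam - mu) * (lam - mu * exp ((mu - lam) * H))\<^sup>2)"
proof -
  define G where "G = exp (H * (mu - lam))"
  have E: "exp (2 * H * (mu - lam)) = G\<^sup>2" by (simp add: G_def mult.assoc flip: exp_double)
  \<comment> \<open>Numerator and denominator of the swapped formula both change sign.\<close>
  have d: "(lam - mu) * (lam - mu * G)\<^sup>2 = - ((mu - lam) * (mu * G - lam)\<^sup>2)"
    by (simp add: algebra_simps power2_eq_square)
  have n: "2 * mu * (lam - mu * G\<^sup>2 + (mu - lam) * G * (1 + H * (mu + lam)))
      = - (2 * mu * (mu * G\<^sup>2 - lam - (mu - lam) * G * (1 + H * (mu + lam))))"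
    by (simp add: algebra_simps)
  show ?thesis
    unfolding mean_00_alt[OF assms[symmetric] G_def] mult.commute[of "mu - lam" H] G_def[symmetric] E d n
    by (rule minus_divide_divide[symmetric])
qed

lemma mean_H0_swap:
  assumes "lam \<noteq> mu"
  shows "mean_H0 mu lam H = exp (H * (mu - lam)) * (4 * lam * mu * (- 1 + exp (H * (mu - lam)))
             + H * (lam\<^sup>2 - mu\<^sup>2) * (lam + mu * exp (H * (mu - lam))))
          / ((lam - mu) * (lam - mu * exp ((mu - lam) * H))\<^sup>2)"
proof -
  define G where "G = exp (H * (mu - lam))"
  have d: "(lam - mu) * (lam - mu * G)\<^sup>2 = - ((mu - lam) * (mu * G - lam)\<^sup>2)"
    by (simp add: algebra_simps power2_eq_square)
  have n: "G * (4 * lam * mu * (- 1 + G) + H * (lam\<^sup>2 - mu\<^sup>2) * (lam + mu * G))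
      = - (lam * G * (mu * (4 + mu * H) - lam\<^sup>2 * H) + mu * G\<^sup>2 * (- 4 * lam + H * (mu\<^sup>2 - lam\<^sup>2)))"
    by (simp add: algebra_simps power2_eq_square)
  show ?thesis
    unfolding mean_H0_alt[OF assms[symmetric] G_def] mult.commute[of "mu - lam" H] G_def[symmetric] d n
    by (rule minus_divide_divide[symmetric])
qed

section \<open>Mean cycle lengths\<close>

lemma cycle_means:
  fixes M :: "'a measure"
    and U D :: "nat \<Rightarrow> 'a \<Rightarrow> real"
    and D0 :: "'a \<Rightarrow> real"
    and lam mu H :: real
  assumes M: "prob_space M"
    and lam: "lam > 0" and mu: "mu > 0" and H: "H > 0"
    and U: "\<And>i. distributed M lborel (U i) (exponential_density lam)"
    and D: "\<And>i. distributed M lborel (D i) (exponential_density mu)"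
    and D0: "distributed M lborel D0 (exponential_density mu)"
    and ind: "prob_space.indep_vars M (\<lambda>_. borel)
           (\<lambda>k :: nat + nat + unit. case k of Inl i \<Rightarrow> U i | Inr (Inl i) \<Rightarrow> D i | Inr (Inr _) \<Rightarrow> D0)
           UNIV"
  shows "has_mean M (\<lambda>\<omega>. C00 H (\<lambda>i. U i \<omega>) (\<lambda>i. D i \<omega>)) (mean_00 lam mu H)"
    and "has_mean M (\<lambda>\<omega>. C0H H (\<lambda>i. U i \<omega>) (\<lambda>i. D i \<omega>)) (mean_H0 mu lam H)"
    and "has_mean M (\<lambda>\<omega>. CH0 H (\<lambda>i. U i \<omega>) (\<lambda>i. D i \<omega>) (D0 \<omega>)) (mean_H0 lam mu H)"
    and "has_mean M (\<lambda>\<omega>. CHH H (\<lambda>i. U i \<omega>) (\<lambda>i. D i \<omega>) (D0 \<omega>)) (mean_00 mu lam H)"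
proof -
  interpret prob_space M by fact
  let ?X = "\<lambda>k :: nat + nat + unit. case k of Inl i \<Rightarrow> U i | Inr (Inl i) \<Rightarrow> D i | Inr (Inr _) \<Rightarrow> D0"
  let ?w = "\<lambda>\<omega>. interleave (\<lambda>i. U i \<omega>) (\<lambda>i. D i \<omega>)"
  let ?v = "\<lambda>\<omega>. case_nat (D0 \<omega>) (?w \<omega>)"
  \<comment> \<open>\<open>f\<close> enumerates the moves from \<open>0\<close>; \<open>g\<close>
    prepends the initial descent for a start at \<open>H\<close>, with an index that
    \<open>f\<close> never takes.\<close>
  define f :: "nat \<Rightarrow> nat + nat + unit"
    where "f k = (if even k then Inl (k div 2) else Inr (Inl (k div 2)))" for k
  define g where "g = case_nat (Inr (Inr ())) f"
  have f_eq: "?X (f k) \<omega> = ?w \<omega> k" for k \<omega>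
    by (simp add: f_def interleave_def)
  have g_eq: "?X (g k) \<omega> = ?v \<omega> k" for k \<omega>
    using f_eq by (auto simp: g_def split: nat.split)
  have inj_f: "inj f"
  proof (rule injI)
    fix j k assume "f j = f k"
    then have "even j = even k" "j div 2 = k div 2" by (auto simp: f_def split: if_splits)
    then show "j = k" by presburger
  qed
  have inj_g: "inj g"
  proof (rule injI)
    fix j k assume "g j = g k"
    moreover have "f i \<noteq> Inr (Inr ())" for i by (simp add: f_def)
    ultimately show "j = k"
      using injD[OF inj_f] by (auto simp: g_def split: nat.splits dest: sym)
  qed
  have law: "distributed M lborel (?X k) (exponential_density (if isl k then lam else mu))" for k
    using U D D0 by (auto split: sum.splits)
  interpret w: alternating_moves M "\<lambda>k \<omega>. ?w \<omega> k" True lam mu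
  proof
    show "indep_vars (\<lambda>_. borel) (\<lambda>k \<omega>. ?w \<omega> k) UNIV"
      using indep_vars_reindex[OF ind inj_f] by (simp add: f_eq[abs_def, symmetric])
    show "distributed M lborel (\<lambda>\<omega>. ?w \<omega> n) (exponential_density (if up_move True n then lam else mu))" for n
      using law[of "f n"] by (simp add: f_eq[abs_def, symmetric] up_move_def) (auto simp: f_def)
  qed fact+
  interpret v: alternating_moves M "\<lambda>k \<omega>. ?v \<omega> k" False lam mu
  proof
    show "indep_vars (\<lambda>_. borel) (\<lambda>k \<omega>. ?v \<omega> k) UNIV"
      using indep_vars_reindex[OF ind inj_g] by (simp add: g_eq[abs_def, symmetric])
    show "distributed M lborel (\<lambda>\<omega>. ?v \<omega> n) (exponential_density (if up_move False n then lam else mu))" for n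
      using law[of "g n"] by (simp add: g_eq[abs_def, symmetric] up_move_def)
        (auto simp: g_def f_def split: nat.splits)
  qed fact+
  \<comment> \<open>The sequence started at \<open>H\<close> contains all three families of
    durations, so its positivity covers both starting points.\<close>
  have path: "AE \<omega> in M. sample_path (\<lambda>i. U i \<omega>) (\<lambda>i. D i \<omega>) \<and> 0 < D0 \<omega>"
    using v.AE_W_pos
  proof eventually_elim
    case (elim \<omega>)
    have "0 < U i \<omega>" for i using elim[rule_format, of "Suc (2 * i)"] by (simp add: interleave_def)
    moreover have "0 < D i \<omega>" for i
      using elim[rule_format, of "Suc (Suc (2 * i))"] by (simp add: interleave_def)
    moreover have "0 < D0 \<omega>" using elim[rule_format, of 0] by simp
    ultimately show ?case by (simp add: sample_path_def)
  qed
  obtain p m where z: "exit_values lam mu H False p m"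
    "m True 0 = mean_00 lam mu H" "m False H = mean_H0 lam mu H"
    using exit_values_zero[OF lam mu H] by blast
  obtain q l where h: "exit_values lam mu H True q l"
    "l True 0 = mean_H0 mu lam H" "l False H = mean_00 mu lam H"
    using exit_values_H[OF lam mu H] by blast
  show "has_mean M (\<lambda>\<omega>. C00 H (\<lambda>i. U i \<omega>) (\<lambda>i. D i \<omega>)) (mean_00 lam mu H)"
    unfolding z(2)[symmetric]
  proof (rule w.has_mean_payoff[OF z(1)])
    show "AE \<omega> in M. \<forall>n. exits H True 0 (?w \<omega>) n \<longrightarrow>
        C00 H (\<lambda>i. U i \<omega>) (\<lambda>i. D i \<omega>) = ennreal (payoff H False True 0 (?w \<omega>) n)"
      using path by eventually_elim (auto intro: sample_path.C0_eq_payoff(1) H)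
  qed (use H in auto)
  show "has_mean M (\<lambda>\<omega>. C0H H (\<lambda>i. U i \<omega>) (\<lambda>i. D i \<omega>)) (mean_H0 mu lam H)"
    unfolding h(2)[symmetric]
  proof (rule w.has_mean_payoff[OF h(1)])
    show "AE \<omega> in M. \<forall>n. exits H True 0 (?w \<omega>) n \<longrightarrow>
        C0H H (\<lambda>i. U i \<omega>) (\<lambda>i. D i \<omega>) = ennreal (payoff H True True 0 (?w \<omega>) n)"
      using path by eventually_elim (auto intro: sample_path.C0_eq_payoff(2) H)
  qed (use H in auto)
  show "has_mean M (\<lambda>\<omega>. CH0 H (\<lambda>i. U i \<omega>) (\<lambda>i. D i \<omega>) (D0 \<omega>)) (mean_H0 lam mu H)"
    unfolding z(3)[symmetric]
  proof (rule v.has_mean_payoff[OF z(1)])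
    show "AE \<omega> in M. \<forall>n. exits H False H (?v \<omega>) n \<longrightarrow>
        CH0 H (\<lambda>i. U i \<omega>) (\<lambda>i. D i \<omega>) (D0 \<omega>) = ennreal (payoff H False False H (?v \<omega>) n)"
      using path by eventually_elim (auto intro: sample_path.CH_eq_payoff(1) H)
  qed (use H in auto)
  show "has_mean M (\<lambda>\<omega>. CHH H (\<lambda>i. U i \<omega>) (\<lambda>i. D i \<omega>) (D0 \<omega>)) (mean_00 mu lam H)"
    unfolding h(3)[symmetric]
  proof (rule v.has_mean_payoff[OF h(1)])
    show "AE \<omega> in M. \<forall>n. exits H False H (?v \<omega>) n \<longrightarrow>
        CHH H (\<lambda>i. U i \<omega>) (\<lambda>i. D i \<omega>) (D0 \<omega>) = ennreal (payoff H True False H (?v \<omega>) n)"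
      using path by eventually_elim (auto intro: sample_path.CH_eq_payoff(2) H)
  qed (use H in auto)
qed

theorem theorem5p1:
  fixes M :: "'a measure"
    and U D :: "nat \<Rightarrow> 'a \<Rightarrow> real"
    and D0 :: "'a \<Rightarrow> real"
    and lam mu H :: real
  assumes "prob_space M"
    and "lam > 0" and "mu > 0" and "H > 0"
    and "\<And>i. distributed M lborel (U i) (exponential_density lam)"
    and "\<And>i. distributed M lborel (D i) (exponential_density mu)"
    and "distributed M lborel D0 (exponential_density mu)"
    and "prob_space.indep_vars M (\<lambda>_. borel)
           (\<lambda>k :: nat + nat + unit. case k of Inl i \<Rightarrow> U i | Inr (Inl i) \<Rightarrow> D i | Inr (Inr _) \<Rightarrow> D0)
           UNIV"
  shows
    "(lam \<noteq> mu \<longrightarrow>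
       has_mean M (\<lambda>\<omega>. C00 H (\<lambda>i. U i \<omega>) (\<lambda>i. D i \<omega>))
         (2 * lam * (lam - mu * exp (2 * H * (mu - lam))
             + (mu - lam) * exp (H * (mu - lam)) * (1 + H * (lam + mu)))
          / ((lam - mu) * (lam - mu * exp (H * (mu - lam)))\<^sup>2)) \<and>
       has_mean M (\<lambda>\<omega>. C0H H (\<lambda>i. U i \<omega>) (\<lambda>i. D i \<omega>))
         (exp (H * (mu - lam)) * (4 * lam * mu * (- 1 + exp (H * (mu - lam)))
             + H * (lam\<^sup>2 - mu\<^sup>2) * (lam + mu * exp (H * (mu - lam))))
          / ((lam - mu) * (lam - mu * exp ((mu - lam) * H))\<^sup>2)) \<and>
       has_mean M (\<lambda>\<omega>. CH0 H (\<lambda>i. U i \<omega>) (\<lambda>i. D i \<omega>) (D0 \<omega>))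
         ((mu * exp (H * (lam - mu)) * (lam * (4 + lam * H) - mu\<^sup>2 * H)
             + lam * exp (2 * H * (lam - mu)) * (- 4 * mu + H * (lam\<^sup>2 - mu\<^sup>2)))
          / ((lam - mu) * (mu - lam * exp (H * (lam - mu)))\<^sup>2)) \<and>
       has_mean M (\<lambda>\<omega>. CHH H (\<lambda>i. U i \<omega>) (\<lambda>i. D i \<omega>) (D0 \<omega>))
         (2 * mu * (lam - mu * exp (2 * H * (mu - lam))
             + (mu - lam) * exp (H * (mu - lam)) * (1 + H * (mu + lam)))
          / ((lam - mu) * (lam - mu * exp ((mu - lam) * H))\<^sup>2))) \<and>
     (lam = mu \<longrightarrow>
       has_mean M (\<lambda>\<omega>. C00 H (\<lambda>i. U i \<omega>) (\<lambda>i. D i \<omega>))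
         (mu * H\<^sup>2 * (3 + 2 * mu * H) / (3 * (1 + mu * H)\<^sup>2)) \<and>
       has_mean M (\<lambda>\<omega>. CHH H (\<lambda>i. U i \<omega>) (\<lambda>i. D i \<omega>) (D0 \<omega>))
         (mu * H\<^sup>2 * (3 + 2 * mu * H) / (3 * (1 + mu * H)\<^sup>2)) \<and>
       has_mean M (\<lambda>\<omega>. C0H H (\<lambda>i. U i \<omega>) (\<lambda>i. D i \<omega>))
         (H * (3 + 3 * mu * H + mu\<^sup>2 * H\<^sup>2) / (3 * (1 + mu * H)\<^sup>2)) \<and>
       has_mean M (\<lambda>\<omega>. CH0 H (\<lambda>i. U i \<omega>) (\<lambda>i. D i \<omega>) (D0 \<omega>))
         (H * (3 + 3 * mu * H + mu\<^sup>2 * H\<^sup>2) / (3 * (1 + mu * H)\<^sup>2)))"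
proof -
  note means = cycle_means[OF assms]
  show ?thesis
  proof (cases "lam = mu")
    case True
    then show ?thesis using means by (simp add: mean_00_def mean_H0_def)
  next
    case False
    then show ?thesis
      using means unfolding mean_00_swap[OF False] mean_H0_swap[OF False]
      by (simp only: mean_00_def mean_H0_def if_False simp_thms)
  qed
qed

end
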